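(* Let $(X,\tau)$ be an admissible pair, let $\mathbf c,\mathbf d\in(\mathbb C(q)^\times)^{I\setminus X}$ and $\mathbf s,\mathbf t\in\mathbb C(q)^{I\setminus X}$, and suppose that $(\mathcal U_q(\mathfrak g'),\mathcal B_{\mathbf c,\mathbf s}(X,\tau))$ and $(\mathcal U_q(\mathfrak g'),\mathcal B_{\mathbf d,\mathbf t}(X,\tau))$ are quantum symmetric pairs with simple generators. Let $U=(u_1,\dots,u_k)$ with $u_j\in I\setminus X$ for all $j$, and let $K_\lambda\in\mathcal A_{\mathrm{reg}}(F_U)$, where $F_U=F_{u_1}F_{u_2}\cdots F_{u_k}$. Then $$K_\lambda F_U\in\check{\mathcal B}_{\mathbf c,\mathbf s}\,\check{\mathcal A}\,\check{\mathcal B}_{\mathbf d,\mathbf t},$$ where the right-hand side is the linear span of all products $bab'$ with $b\in\check{\mathcal B}_{\mathbf c,\mathbf s}$, $a\in\check{\mathcal A}$, $b'\in\check{\mathcal B}_{\mathbf d,\mathbf t}$.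
   Context: **Quantized enveloping algebra.** $I$ is a finite set and $(a_{ij})_{i,j\in I}$ is a symmetrizable generalized Cartan matrix; $\epsilon_i$ ($i\in I$) are positive integers, coprime on each indecomposable block, with $\epsilon_ia_{ij}=\epsilon_ja_{ji}$. $Q=\bigoplus_{i\in I}\mathbb Z\alpha_i$ is the root lattice, with symmetric bilinear form $(\alpha_i,\alpha_j)=\epsilon_ia_{ij}$, extended to $\check Q=\frac12Q$. $Q^\vee=\bigoplus_{i\in I}\mathbb Zh_i$ is the coroot lattice, $\alpha_i(h_j)=a_{ji}$. Put $q_i=q^{\epsilon_i}$. $\check{\mathcal U}_q(\mathfrak g')$ is the unital associative $\mathbb C(q^{1/2})$-algebra generated by $E_i,F_i$ ($i\in I$) and $K_h$ ($h\in\frac12Q^\vee$) with relations $K_0=1$, $K_hK_{h'}=K_{h+h'}$, $K_hE_i=q^{\alpha_i(h)}E_iK_h$, $K_hF_i=q^{-\alpha_i(h)}F_iK_h$, $[E_i,F_j]=\delta_{ij}\frac{K_i-K_i^{-1}}{q_i-q_i^{-1}}$ with $K_i=K_{\epsilon_ih_i}$, and the quantum Serre relations $\sum_{n=0}^{1-a_{ij}}(-1)^n\left[{1-a_{ij}\atop n}\right]_{q_i}Z_i^{1-a_{ij}-n}Z_jZ_i^n=0$ for $i\ne j$ and $Z=E$ or $Z=F$. For $\beta=\sum_in_i\alpha_i\in\check Q$ put $K_\beta=K_{\sum_in_i\epsilon_ih_i}$; so $K_{\alpha_i}=K_i$, $K_\beta E_i=q^{(\beta,\alpha_i)}E_iK_\beta$,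 $K_\beta F_i=q^{-(\beta,\alpha_i)}F_iK_\beta$. $\mathcal U_q(\mathfrak g')\subset\check{\mathcal U}_q(\mathfrak g')$ is the $\mathbb C(q)$-subalgebra generated by $E_i,F_i,K_i^{\pm1}$ ($i\in I$). **Admissible pairs.** Let $X\subseteq I$ be such that $(a_{ij})_{i,j\in X}$ is of finite type, let $w_X$ be the longest element of the group $W_X$ generated by the reflections $r_i(\alpha)=\alpha-\alpha(h_i)\alpha_i$, $i\in X$, and let $\rho_X^\vee$ be the half sum of the positive coroots of the root system of $X$. Let $\tau$ be a permutation of $I$ with $a_{\tau(i)\tau(j)}=a_{ij}$ and $\tau(X)=X$. $(X,\tau)$ is admissible if $\tau^2=\mathrm{id}$; $-w_X(\alpha_j)=\alpha_{\tau(j)}$ for $j\in X$; and $\alpha_j(\rho_X^\vee)\in\mathbb Z$ whenever $j\in I\setminus X$ and $\tau(j)=j$. Put $\Theta(\alpha)=-w_X\tau(\alpha)$ with $\tau(\alpha_i)=\alpha_{\tau(i)}$. **Quantum involution.** $\theta_q=\mathrm{Ad}(s)\circ T_{w_X}\circ\psi\circ\tau\circ\omega$ is the algebra automorphism of $\mathcal U_q(\mathfrak g')$ built from: $\omega(E_i)=-F_i$, $\omega(F_i)=-E_i$, $\omega(K_i)=K_i^{-1}$; $\tau(Z_i)=Z_{\tau(i)}$ for $Z=E,F,K$; $\psi(E_i)=E_iK_i$, $\psi(F_i)=K_i^{-1}F_i$, $\psi(K_i)=K_i$; $T_{w_X}=T_{i_1}\cdots T_{i_r}$ for a reduced expression $w_X=r_{i_1}\cdots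 r_{i_r}$, with Lusztig's automorphisms $T_i(E_i)=-F_iK_i$, $T_i(F_i)=-K_i^{-1}E_i$, $T_i(K_\beta)=K_{r_i\beta}$ and, for $j\neq i$, $T_i(E_j)=\sum_{r+s=-a_{ij}}(-1)^rq_i^{-r}E_i^{(s)}E_jE_i^{(r)}$, $T_i(F_j)=\sum_{r+s=-a_{ij}}(-1)^rq_i^{r}F_i^{(r)}F_jF_i^{(s)}$, where $Z^{(n)}_i=Z_i^n/[n]_{q_i}!$; and $\mathrm{Ad}(s)$ multiplies elements of weight $\beta\in Q$ by $s(\beta)$, where $s:Q\to\mathbb C^\times$ is the homomorphism with (for a fixed total order on $I$) $s(\alpha_j)=1$ if $j\in X$ or $\tau(j)=j$, and $s(\alpha_j)=(\sqrt{-1})^{\alpha_j(2\rho_X^\vee)}$, resp. $(-\sqrt{-1})^{\alpha_j(2\rho_X^\vee)}$, if $j\notin X$ and $\tau(j)>j$, resp. $\tau(j)<j$. **Coideal subalgebras.** For $\mathbf c\in(\mathbb C(q)^\times)^{I\setminus X}$, $\mathbf s\in\mathbb C(q)^{I\setminus X}$, $\mathcal B_{\mathbf c,\mathbf s}=\mathcal B_{\mathbf c,\mathbf s}(X,\tau)$ is the subalgebra of $\mathcal U_q(\mathfrak g')$ generated by $E_i,F_i,K_i^{\pm1}$ ($i\in X$), by $K_\beta$ ($\beta\in Q$, $\Theta(\beta)=\beta$) and by $B_i=F_i+c_i\theta_q(F_iK_i)K_i^{-1}+s_iK_i^{-1}$ ($i\in I\setminus X$). The pair $(\mathcal U_q(\mathfrak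 g'),\mathcal B_{\mathbf c,\mathbf s})$ is the quantum symmetric pair of $(X,\tau)$; it has simple generators if for every $i\in I\setminus X$ there is $v_i\in\mathbb C(q)^\times$ with $\theta_q(F_iK_i)=-v_iE_{\tau(i)}$. $\check{\mathcal B}_{\mathbf c,\mathbf s}$ is the $\mathbb C(q^{1/2})$-subalgebra of $\check{\mathcal U}_q(\mathfrak g')$ generated by the $B_i$ ($i\in I\setminus X$), $E_i,F_i$ ($i\in X$), $K_\beta$ for $\beta\in\frac12\bigoplus_{i\in X}\mathbb Z\alpha_i$, and $K_\beta$ for $\beta\in\check Q$ with $\Theta(\beta)=\beta$. The quantum torus $\check{\mathcal A}$ is the $\mathbb C(q^{1/2})$-subalgebra generated by all $K_\beta$ with $\beta\in\check Q$, $\Theta(\beta)=-\beta$. **Regular points.** Put $\mu_i=\frac12(\alpha_i-\Theta(\alpha_i))$. $\mathcal A_{\mathrm{reg}}(1)$ (the case $k=0$, $F_U=1$) consists of all $K_\lambda$ with $\lambda\in\check Q$, $\Theta(\lambda)=-\lambda$. For $k>0$ and $U=(u_1,\dots,u_k)\in(I\setminus X)^k$, $\mathcal A_{\mathrm{reg}}(F_U)$ is the set of all $K_\lambda$ with $\lambda\in\check Q$, $\Theta(\lambda)=-\lambda$, such that $$\frac{c_{v_1}\cdots c_{v_{k-\ell}}}{d_{v_1}\cdots d_{v_{k-\ell}}}\neq q^{\,\sum_{i=1}^{k-\ell}(\lambda+\mu,\alpha_{v_i}+\alpha_{\tau(v_i)})-\sum_{1\le i,j\le k-\ell,\,i\ne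 j}(\alpha_{v_i},\alpha_{v_j})}$$ for all $0\le\ell<k$, all subsequences $(v_1,\dots,v_{k-\ell})$ of $U$, and all $\mu=N_1\mu_{u_1}+\dots+N_k\mu_{u_k}$ with $N_j\in\{-1,0,1\}$. *)

theory Defs
  imports
    "HOL-Analysis.Analysis"
    "HOL-Algebra.QuotRing"
    "HOL-Algebra.Generated_Rings"
    "HOL-Library.Poly_Mapping"
    "HOL-Library.Sublist"
    "HOL-Computational_Algebra.Fraction_Field"
begin

section \<open>The ground field\<close>

text \<open>The ground field \<open>\<complex>(q\<^bsup>1/2\<^esup>)\<close> is the field of rational functions in the
  indeterminate \<open>q\<^bsup>1/2\<^esup>\<close>; \<open>\<complex>(q)\<close> is its subfield of rational functions in the square
  of that indeterminate.\<close>

type_synonym qfield = "complex poly fract"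

definition of_cpx :: "complex \<Rightarrow> qfield" where
  "of_cpx z = Fract [:z:] 1"

definition qhalf :: qfield where
  "qhalf = Fract [:0, 1:] 1"

definition Cq :: "qfield set" where
  "Cq = {Fract (p \<circ>\<^sub>p [:0, 0, 1:]) (r \<circ>\<^sub>p [:0, 0, 1:]) | p r. r \<noteq> 0}"

text \<open>\<open>q\<^sup>x\<close>, for \<open>x \<in> \<half>\<int>\<close> only.\<close>

definition qpow :: "real \<Rightarrow> qfield" where
  "qpow x = qhalf powi \<lfloor>2 * x\<rfloor>"

definition qint :: "qfield \<Rightarrow> nat \<Rightarrow> qfield" where
  "qint p n = (p ^ n - inverse p ^ n) / (p - inverse p)"

definition qfact :: "qfield \<Rightarrow> nat \<Rightarrow> qfield" where
  "qfact p n = (\<Prod>k = 1..n. qint p k)"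

definition qbinom :: "qfield \<Rightarrow> nat \<Rightarrow> nat \<Rightarrow> qfield" where
  "qbinom p n k = qfact p n / (qfact p k * qfact p (n - k))"


section \<open>Cartan data, root and coroot lattices\<close>

text \<open>The finite index set \<open>I\<close> is the type \<open>'i\<close>. The equivalence classes of
  \<open>{(j, k). a j k \<noteq> 0}\<^sup>*\<close> are the indecomposable blocks.\<close>

definition symmetrizable_gcm :: "('i::finite \<Rightarrow> 'i \<Rightarrow> int) \<Rightarrow> ('i \<Rightarrow> int) \<Rightarrow> bool" where
  "symmetrizable_gcm a e \<longleftrightarrow>
     (\<forall>i. a i i = 2) \<and>
     (\<forall>i j. i \<noteq> j \<longrightarrow> a i j \<le> 0) \<and>
     (\<forall>i j. a i j = 0 \<longrightarrow> a j i = 0) \<and>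
     (\<forall>i. e i > 0) \<and>
     (\<forall>i j. e i * a i j = e j * a j i) \<and>
     (\<forall>i. Gcd (e ` {j. (i, j) \<in> {(k, l). a k l \<noteq> 0}\<^sup>*}) = 1)"

text \<open>The root and coroot lattices live inside coordinate spaces, with respect to the bases
  \<open>\<alpha>\<^sub>i\<close> and \<open>h\<^sub>i\<close>, respectively.\<close>

abbreviation sroot :: "'i::finite \<Rightarrow> real ^ 'i" where
  "sroot i \<equiv> axis i 1"

definition half_root_lattice :: "(real ^ 'i::finite) set" where
  "half_root_lattice = {b. \<forall>i. 2 * b $ i \<in> \<int>}"

definition form :: "('i::finite \<Rightarrow> 'i \<Rightarrow> int) \<Rightarrow> ('i \<Rightarrow> int) \<Rightarrow> real ^ 'i \<Rightarrow> real ^ 'i \<Rightarrow> real" where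
  "form a e b c = (\<Sum>i\<in>UNIV. \<Sum>j\<in>UNIV. b $ i * c $ j * of_int (e i * a i j))"

text \<open>\<open>\<beta>(h\<^sub>i)\<close> and \<open>\<alpha>\<^sub>i(h)\<close>, using \<open>\<alpha>\<^sub>i(h\<^sub>j) = a\<^sub>j\<^sub>i\<close>. The ring of coefficients is left open
  because coroot vectors occur with real and with integer coordinates.\<close>

definition eval_coroot :: "('i::finite \<Rightarrow> 'i \<Rightarrow> int) \<Rightarrow> 'i \<Rightarrow> ('r::comm_ring_1) ^ 'i \<Rightarrow> 'r" where
  "eval_coroot a i b = (\<Sum>j\<in>UNIV. b $ j * of_int (a i j))"

definition eval_root :: "('i::finite \<Rightarrow> 'i \<Rightarrow> int) \<Rightarrow> 'i \<Rightarrow> ('r::comm_ring_1) ^ 'i \<Rightarrow> 'r" where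
  "eval_root a i h = (\<Sum>j\<in>UNIV. h $ j * of_int (a j i))"

definition simple_refl :: "('i::finite \<Rightarrow> 'i \<Rightarrow> int) \<Rightarrow> 'i \<Rightarrow> real ^ 'i \<Rightarrow> real ^ 'i" where
  "simple_refl a i b = b - axis i (eval_coroot a i b)"

definition simple_corefl :: "('i::finite \<Rightarrow> 'i \<Rightarrow> int) \<Rightarrow> 'i \<Rightarrow> ('r::comm_ring_1) ^ 'i \<Rightarrow> 'r ^ 'i" where
  "simple_corefl a i h = h - axis i (eval_root a i h)"

text \<open>The product \<open>r\<^bsub>i\<^sub>1\<^esub> \<cdots> r\<^bsub>i\<^sub>r\<^esub>\<close> of the reflections listed in a word. The group \<open>W\<^sub>X\<close>
  consists of these for the words in \<open>X\<close> (reflections are involutions). The longest element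
  \<open>w\<^sub>X\<close> is always given by a reduced expression of it, which is needed anyway for
  \<open>T\<^bsub>w\<^sub>X\<^esub>\<close>.\<close>

definition weyl :: "('i::finite \<Rightarrow> 'i \<Rightarrow> int) \<Rightarrow> 'i list \<Rightarrow> real ^ 'i \<Rightarrow> real ^ 'i" where
  "weyl a ws b = foldr (simple_refl a) ws b"

definition reduced_word :: "('i::finite \<Rightarrow> 'i \<Rightarrow> int) \<Rightarrow> 'i set \<Rightarrow> 'i list \<Rightarrow> bool" where
  "reduced_word a X ws \<longleftrightarrow> set ws \<subseteq> X \<and>
     (\<forall>ws'. set ws' \<subseteq> X \<and> weyl a ws' = weyl a ws \<longrightarrow> length ws \<le> length ws')"

definition reduced_word_of_longest ::
    "('i::finite \<Rightarrow> 'i \<Rightarrow> int) \<Rightarrow> 'i set \<Rightarrow> 'i list \<Rightarrow> bool" where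
  "reduced_word_of_longest a X ws \<longleftrightarrow> reduced_word a X ws \<and>
     (\<forall>ws'. reduced_word a X ws' \<longrightarrow> length ws' \<le> length ws)"

definition finite_type ::
    "('i::finite \<Rightarrow> 'i \<Rightarrow> int) \<Rightarrow> ('i \<Rightarrow> int) \<Rightarrow> 'i set \<Rightarrow> bool" where
  "finite_type a e X \<longleftrightarrow> (\<forall>b. b \<noteq> 0 \<and> (\<forall>i. i \<notin> X \<longrightarrow> b $ i = 0) \<longrightarrow> form a e b b > 0)"

definition pos_coroots :: "('i::finite \<Rightarrow> 'i \<Rightarrow> int) \<Rightarrow> 'i set \<Rightarrow> (real ^ 'i) set" where
  "pos_coroots a X =
     {h. (\<exists>ws i. set ws \<subseteq> X \<and> i \<in> X \<and> h = foldr (simple_corefl a) ws (axis i 1)) \<and> (\<forall>k. h $ k \<ge> 0)}"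

definition rho_check :: "('i::finite \<Rightarrow> 'i \<Rightarrow> int) \<Rightarrow> 'i set \<Rightarrow> real ^ 'i" where
  "rho_check a X = (1 / 2) *\<^sub>R (\<Sum>h\<in>pos_coroots a X. h)"


section \<open>Admissible pairs\<close>

definition permute :: "('i::finite \<Rightarrow> 'i) \<Rightarrow> 'r ^ 'i \<Rightarrow> 'r ^ 'i" where
  "permute \<tau> b = (\<chi> i. b $ inv_into UNIV \<tau> i)"

definition admissible_pair :: "('i::finite \<Rightarrow> 'i \<Rightarrow> int) \<Rightarrow> ('i \<Rightarrow> int) \<Rightarrow> 'i set \<Rightarrow>
    ('i \<Rightarrow> 'i) \<Rightarrow> 'i list \<Rightarrow> bool" where
  "admissible_pair a e X \<tau> ws \<longleftrightarrow>
     finite_type a e X \<and>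
     reduced_word_of_longest a X ws \<and>
     bij \<tau> \<and> (\<forall>i j. a (\<tau> i) (\<tau> j) = a i j) \<and> \<tau> ` X = X \<and>
     \<tau> \<circ> \<tau> = id \<and>
     (\<forall>j\<in>X. - weyl a ws (sroot j) = sroot (\<tau> j)) \<and>
     (\<forall>j. j \<notin> X \<and> \<tau> j = j \<longrightarrow> eval_root a j (rho_check a X) \<in> \<int>)"

definition Theta :: "('i::finite \<Rightarrow> 'i \<Rightarrow> int) \<Rightarrow> ('i \<Rightarrow> 'i) \<Rightarrow> 'i list \<Rightarrow> real ^ 'i \<Rightarrow> real ^ 'i" where
  "Theta a \<tau> ws b = - weyl a ws (permute \<tau> b)"


section \<open>Free algebras\<close>

text \<open>The free algebra on a set of generators is the monoid algebra of the free monoid, which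
  for the use of \<open>poly_mapping\<close> is an additively written type of words.\<close>

datatype 'g word = Word (letters: "'g list")

instantiation word :: (type) monoid_add
begin

definition "0 = Word []"

definition "x + y = Word (letters x @ letters y)"

instance
  by standard (simp_all add: zero_word_def plus_word_def)

end

type_synonym 'g free_alg = "'g word \<Rightarrow>\<^sub>0 qfield"

definition scal :: "qfield \<Rightarrow> 'g free_alg" where
  "scal c = Poly_Mapping.single 0 c"

definition gen :: "'g \<Rightarrow> 'g free_alg" where
  "gen g = Poly_Mapping.single (Word [g]) 1"

text \<open>The algebra endomorphism with prescribed values on the generators.\<close>

definition subst :: "('g \<Rightarrow> 'g free_alg) \<Rightarrow> 'g free_alg \<Rightarrow> 'g free_alg" where
  "subst f x = (\<Sum>w\<in>Poly_Mapping.keys x.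
     scal (Poly_Mapping.lookup x w) * prod_list (map f (letters w)))"

lemma scal_add: "scal (c + d) = scal c + scal d"
  by (simp add: scal_def single_add)

lemma scal_mult: "scal (c * d) = scal c * scal d"
  by (simp add: scal_def mult_single)

lemma scal_zero [simp]: "scal 0 = 0"
  by (simp add: scal_def)

lemma scal_one [simp]: "scal 1 = 1"
  by (simp add: scal_def)

lemma free_alg_induct [case_names single sum]:
  assumes single: "\<And>w c. P (Poly_Mapping.single w c)"
    and sum: "\<And>x y. P x \<Longrightarrow> P y \<Longrightarrow> P (x + y)"
  shows "P (x :: 'g free_alg)"
proof (induction x rule: update_induct)
  case const
  then show ?case using single[of 0 0] by simp
next
  case (update f w c)
  then have "Poly_Mapping.update w c f = f + Poly_Mapping.single w c"
    by (intro poly_mapping_eqI)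
      (auto simp: lookup_update lookup_add lookup_single in_keys_iff when_def)
  then show ?case using sum[OF update(3) single] by simp
qed

lemma scal_commute: "scal c * x = x * scal c"
  by (induction x rule: free_alg_induct)
    (simp_all add: scal_def mult_single distrib_left distrib_right mult.commute)

lemma subst_superset:
  assumes "finite S" "Poly_Mapping.keys x \<subseteq> S"
  shows "subst f x = (\<Sum>w\<in>S. scal (Poly_Mapping.lookup x w) * prod_list (map f (letters w)))"
  unfolding subst_def
  by (rule sum.mono_neutral_left) (use assms in \<open>auto simp: in_keys_iff\<close>)

lemma subst_add: "subst f (x + y) = subst f x + subst f y"
proof -
  let ?S = "Poly_Mapping.keys x \<union> Poly_Mapping.keys y"
  have "Poly_Mapping.keys (x + y) \<subseteq> ?S"
    by (rule Poly_Mapping.keys_add)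
  then show ?thesis
    by (simp add: subst_superset[of ?S] lookup_add scal_add distrib_right sum.distrib)
qed

lemma subst_single: "subst f (Poly_Mapping.single w c) = scal c * prod_list (map f (letters w))"
  by (subst subst_superset[of "{w}"]) auto

lemma subst_gen [simp]: "subst f (gen g) = f g"
  by (simp add: gen_def subst_single)

lemma subst_scal [simp]: "subst f (scal c) = scal c"
  by (simp add: scal_def subst_single zero_word_def)

lemma subst_mult: "subst f (x * y) = subst f x * subst f y"
proof (induction x rule: free_alg_induct)
  case (single v c)
  show ?case
  proof (induction y rule: free_alg_induct)
    case (single w d)
    let ?p = "prod_list (map f (letters v))" and ?r = "prod_list (map f (letters w))"
    have "scal (c * d) * (?p * ?r) = scal c * (scal d * ?p) * ?r"
      by (simp add: scal_mult mult.assoc)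
    also have "\<dots> = (scal c * ?p) * (scal d * ?r)"
      by (simp add: scal_commute[of d ?p] mult.assoc)
    finally show ?case
      by (simp add: mult_single subst_single plus_word_def)
  next
    case (sum x y)
    then show ?case
      by (simp add: distrib_left subst_add)
  qed
next
  case (sum x y)
  then show ?case
    by (simp add: distrib_right subst_add)
qed


section \<open>The quantized enveloping algebra\<close>

text \<open>\<open>GenK m\<close> is \<open>K\<^sub>h\<close> for \<open>h = \<half> \<Sum>\<^sub>i m\<^sub>i h\<^sub>i\<close>, so the integer vectors \<open>m\<close> run through
  \<open>\<half>Q\<^sup>\<or>\<close>. Accordingly \<open>q\<^bsup>\<alpha>\<^sub>i(h)\<^esup>\<close> is the \<open>\<alpha>\<^sub>i(m)\<close>-th power of \<open>q\<^bsup>1/2\<^esup>\<close>.\<close>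

datatype (dead 'i::finite) qgen = GenE 'i | GenF 'i | GenK "int ^ 'i"

type_synonym 'i qfree = "'i qgen free_alg"

abbreviation FE :: "'i::finite \<Rightarrow> 'i qfree" where "FE i \<equiv> gen (GenE i)"
abbreviation FF :: "'i::finite \<Rightarrow> 'i qfree" where "FF i \<equiv> gen (GenF i)"
abbreviation FK :: "int ^ 'i::finite \<Rightarrow> 'i qfree" where "FK m \<equiv> gen (GenK m)"

definition qi :: "('i \<Rightarrow> int) \<Rightarrow> 'i \<Rightarrow> qfield" where
  "qi e i = qpow (of_int (e i))"

text \<open>\<open>K\<^sub>\<beta> = K\<^sub>h\<close> with \<open>h = \<Sum>\<^sub>i \<beta>\<^sub>i \<epsilon>\<^sub>i h\<^sub>i\<close>, for \<open>\<beta> \<in> \<half>Q\<close> only.\<close>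

definition FKb :: "('i::finite \<Rightarrow> int) \<Rightarrow> real ^ 'i \<Rightarrow> 'i qfree" where
  "FKb e b = FK (\<chi> i. \<lfloor>2 * (b $ i * of_int (e i))\<rfloor>)"

definition serre :: "('i::finite \<Rightarrow> 'i \<Rightarrow> int) \<Rightarrow> ('i \<Rightarrow> int) \<Rightarrow> ('i \<Rightarrow> 'i qfree) \<Rightarrow> 'i \<Rightarrow> 'i \<Rightarrow> 'i qfree" where
  "serre a e Z i j = (let m = nat (1 - a i j) in
     \<Sum>n\<le>m. scal ((-1) ^ n * qbinom (qi e i) m n) * Z i ^ (m - n) * Z j * Z i ^ n)"

inductive_set relators :: "('i::finite \<Rightarrow> 'i \<Rightarrow> int) \<Rightarrow> ('i \<Rightarrow> int) \<Rightarrow> 'i qfree set"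
  for a e where
  K_zero: "FK 0 - 1 \<in> relators a e"
| K_add: "FK h * FK h' - FK (h + h') \<in> relators a e"
| K_E: "FK h * FE i - scal (qhalf powi eval_root a i h) * FE i * FK h \<in> relators a e"
| K_F: "FK h * FF i - scal (qhalf powi (- eval_root a i h)) * FF i * FK h \<in> relators a e"
| E_F: "FE i * FF j - FF j * FE i -
    (if i = j then scal (1 / (qi e i - inverse (qi e i))) * (FKb e (sroot i) - FKb e (- sroot i)) else 0)
    \<in> relators a e"
| serre_E: "i \<noteq> j \<Longrightarrow> serre a e FE i j \<in> relators a e"
| serre_F: "i \<noteq> j \<Longrightarrow> serre a e FF i j \<in> relators a e"

definition qfree_ring :: "'i::finite qfree ring" where
  "qfree_ring = \<lparr>carrier = UNIV, monoid.mult = (*), one = 1, zero = 0, add = (+)\<rparr>"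

lemma ring_qfree_ring: "ring qfree_ring"
proof -
  have "\<exists>y. x + y = 0" for x :: "'i::finite qfree"
    by (rule exI[of _ "- x"]) simp
  then show ?thesis
    unfolding qfree_ring_def
    by unfold_locales (auto simp: algebra_simps Units_def)
qed

definition rel_ideal :: "('i::finite \<Rightarrow> 'i \<Rightarrow> int) \<Rightarrow> ('i \<Rightarrow> int) \<Rightarrow> 'i qfree set" where
  "rel_ideal a e = genideal qfree_ring (relators a e)"

definition Uq :: "('i::finite \<Rightarrow> 'i \<Rightarrow> int) \<Rightarrow> ('i \<Rightarrow> int) \<Rightarrow> 'i qfree set ring" where
  "Uq a e = qfree_ring Quot rel_ideal a e"

text \<open>The canonical projection from the free algebra.\<close>

definition cls :: "('i::finite \<Rightarrow> 'i \<Rightarrow> int) \<Rightarrow> ('i \<Rightarrow> int) \<Rightarrow> 'i qfree \<Rightarrow> 'i qfree set" where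
  "cls a e x = rel_ideal a e +>\<^bsub>qfree_ring\<^esub> x"

definition Kb :: "('i::finite \<Rightarrow> 'i \<Rightarrow> int) \<Rightarrow> ('i \<Rightarrow> int) \<Rightarrow> real ^ 'i \<Rightarrow> 'i qfree set" where
  "Kb a e b = cls a e (FKb e b)"

definition Fword :: "('i::finite \<Rightarrow> 'i \<Rightarrow> int) \<Rightarrow> ('i \<Rightarrow> int) \<Rightarrow> 'i list \<Rightarrow> 'i qfree set" where
  "Fword a e us = cls a e (prod_list (map FF us))"

text \<open>Subalgebra generated by, and linear span of, a set, over \<open>\<complex>(q\<^bsup>1/2\<^esup>)\<close>.\<close>

definition subalg :: "('i::finite \<Rightarrow> 'i \<Rightarrow> int) \<Rightarrow> ('i \<Rightarrow> int) \<Rightarrow> 'i qfree set set \<Rightarrow> 'i qfree set set" where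
  "subalg a e S = generate_ring (Uq a e) ({cls a e (scal c) | c. True} \<union> S)"

inductive_set lin_span ::
    "('i::finite \<Rightarrow> 'i \<Rightarrow> int) \<Rightarrow> ('i \<Rightarrow> int) \<Rightarrow> 'i qfree set set \<Rightarrow> 'i qfree set set"
  for a e S where
  zero: "\<zero>\<^bsub>Uq a e\<^esub> \<in> lin_span a e S"
| step: "x \<in> S \<Longrightarrow> y \<in> lin_span a e S \<Longrightarrow>
    (cls a e (scal c) \<otimes>\<^bsub>Uq a e\<^esub> x) \<oplus>\<^bsub>Uq a e\<^esub> y \<in> lin_span a e S"


section \<open>The quantum involution\<close>

text \<open>Each of the automorphisms entering \<open>\<theta>\<^sub>q\<close> is given by its values on generators, i.e.\ it is
  induced by a substitution of the free algebra (extended to the \<open>K\<^sub>h\<close> with \<open>h \<in> \<half>Q\<^sup>\<or>\<close> in the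
  evident way: \<open>T\<^sub>i(K\<^sub>h) = K\<^bsub>r\<^sub>i h\<^esub>\<close> is compatible with \<open>T\<^sub>i(K\<^sub>\<beta>) = K\<^bsub>r\<^sub>i \<beta>\<^esub>\<close>). The substitutions
  preserve the ideal of relations (for \<open>T\<^sub>i\<close> this is Lusztig's theorem); the composite \<open>theta_free\<close> of these substitutions induces \<open>\<theta>\<^sub>q\<close>. Hence
  \<open>\<theta>\<^sub>q\<close> of the class of \<open>x\<close> is the class of \<open>theta_free \<dots> x\<close>.\<close>

fun omega_gen :: "'i::finite qgen \<Rightarrow> 'i qfree" where
  "omega_gen (GenE i) = - FF i"
| "omega_gen (GenF i) = - FE i"
| "omega_gen (GenK m) = FK (- m)"

fun tau_gen :: "('i::finite \<Rightarrow> 'i) \<Rightarrow> 'i qgen \<Rightarrow> 'i qfree" where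
  "tau_gen \<tau> (GenE i) = FE (\<tau> i)"
| "tau_gen \<tau> (GenF i) = FF (\<tau> i)"
| "tau_gen \<tau> (GenK m) = FK (permute \<tau> m)"

fun psi_gen :: "('i::finite \<Rightarrow> int) \<Rightarrow> 'i qgen \<Rightarrow> 'i qfree" where
  "psi_gen e (GenE i) = FE i * FKb e (sroot i)"
| "psi_gen e (GenF i) = FKb e (- sroot i) * FF i"
| "psi_gen e (GenK m) = FK m"

text \<open>\<open>Z\<^sub>i\<^bsup>(n)\<^esup>\<close>\<close>

definition divpow :: "('i \<Rightarrow> int) \<Rightarrow> ('i::finite \<Rightarrow> 'i qfree) \<Rightarrow> 'i \<Rightarrow> nat \<Rightarrow> 'i qfree" where
  "divpow e Z i n = scal (1 / qfact (qi e i) n) * Z i ^ n"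

fun T_gen :: "('i::finite \<Rightarrow> 'i \<Rightarrow> int) \<Rightarrow> ('i \<Rightarrow> int) \<Rightarrow> 'i \<Rightarrow> 'i qgen \<Rightarrow> 'i qfree" where
  "T_gen a e i (GenE j) = (if j = i then - (FF i * FKb e (sroot i)) else
     (let m = nat (- a i j) in
       \<Sum>r\<le>m. scal ((-1) ^ r * qi e i powi (- int r)) * divpow e FE i (m - r) * FE j * divpow e FE i r))"
| "T_gen a e i (GenF j) = (if j = i then - (FKb e (- sroot i) * FE i) else
     (let m = nat (- a i j) in
       \<Sum>r\<le>m. scal ((-1) ^ r * qi e i powi int r) * divpow e FF i r * FF j * divpow e FF i (m - r)))"
| "T_gen a e i (GenK m) = FK (simple_corefl a i m)"

text \<open>\<open>s\<close> on simple roots, and its extension to a homomorphism on \<open>Q\<close>. The exponent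
  \<open>\<alpha>\<^sub>j(2\<rho>\<^sub>X\<^sup>\<or>)\<close> is an integer.\<close>

definition s_simple :: "('i::{finite, linorder} \<Rightarrow> 'i \<Rightarrow> int) \<Rightarrow> 'i set \<Rightarrow> ('i \<Rightarrow> 'i) \<Rightarrow> 'i \<Rightarrow> complex" where
  "s_simple a X \<tau> j =
     (if j \<in> X \<or> \<tau> j = j then 1
      else (if \<tau> j > j then \<i> else - \<i>) powi \<lfloor>eval_root a j (2 *\<^sub>R rho_check a X)\<rfloor>)"

definition s_char :: "('i::{finite, linorder} \<Rightarrow> 'i \<Rightarrow> int) \<Rightarrow> 'i set \<Rightarrow> ('i \<Rightarrow> 'i) \<Rightarrow> (real, 'i) vec \<Rightarrow> complex" where
  "s_char a X \<tau> b = (\<Prod>j\<in>UNIV. s_simple a X \<tau> j powi \<lfloor>b $ j\<rfloor>)"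

fun Ad_gen :: "('i::{finite, linorder} \<Rightarrow> 'i \<Rightarrow> int) \<Rightarrow> 'i set \<Rightarrow> ('i \<Rightarrow> 'i) \<Rightarrow> 'i qgen \<Rightarrow> 'i qfree" where
  "Ad_gen a X \<tau> (GenE i) = scal (of_cpx (s_char a X \<tau> (sroot i))) * FE i"
| "Ad_gen a X \<tau> (GenF i) = scal (of_cpx (s_char a X \<tau> (- sroot i))) * FF i"
| "Ad_gen a X \<tau> (GenK m) = FK m"

definition theta_free :: "('i::{finite, linorder} \<Rightarrow> 'i \<Rightarrow> int) \<Rightarrow> ('i \<Rightarrow> int) \<Rightarrow> 'i set \<Rightarrow>
    ('i \<Rightarrow> 'i) \<Rightarrow> 'i list \<Rightarrow> 'i qfree \<Rightarrow> 'i qfree" where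
  "theta_free a e X \<tau> ws =
     subst (Ad_gen a X \<tau>) \<circ> foldr (\<lambda>i f. subst (T_gen a e i) \<circ> f) ws id \<circ>
     subst (psi_gen e) \<circ> subst (tau_gen \<tau>) \<circ> subst omega_gen"


section \<open>Quantum symmetric pair coideal subalgebras\<close>

text \<open>Having simple generators is a property of \<open>(X, \<tau>)\<close> alone; it does not involve the
  parameters \<open>\<^bold>c\<close>, \<open>\<^bold>s\<close> of the quantum symmetric pair.\<close>

definition simple_generators :: "('i::{finite, linorder} \<Rightarrow> 'i \<Rightarrow> int) \<Rightarrow> ('i \<Rightarrow> int) \<Rightarrow> 'i set \<Rightarrow>
    ('i \<Rightarrow> 'i) \<Rightarrow> 'i list \<Rightarrow> bool" where
  "simple_generators a e X \<tau> ws \<longleftrightarrow>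
     (\<forall>i. i \<notin> X \<longrightarrow> (\<exists>v. v \<in> Cq \<and> v \<noteq> 0 \<and>
        cls a e (theta_free a e X \<tau> ws (FF i * FKb e (sroot i))) = cls a e (- (scal v * FE (\<tau> i)))))"

text \<open>\<open>c\<close> and \<open>s\<close> are indexed by \<open>I - X\<close>; their values on \<open>X\<close> are never used.\<close>

definition qsp_parameters :: "'i set \<Rightarrow> ('i \<Rightarrow> qfield) \<Rightarrow> ('i \<Rightarrow> qfield) \<Rightarrow> bool" where
  "qsp_parameters X c s \<longleftrightarrow> (\<forall>i. i \<notin> X \<longrightarrow> c i \<in> Cq \<and> c i \<noteq> 0 \<and> s i \<in> Cq)"

definition Bgen :: "('i::{finite, linorder} \<Rightarrow> 'i \<Rightarrow> int) \<Rightarrow> ('i \<Rightarrow> int) \<Rightarrow> 'i set \<Rightarrow>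
    ('i \<Rightarrow> 'i) \<Rightarrow> 'i list \<Rightarrow> ('i \<Rightarrow> qfield) \<Rightarrow> ('i \<Rightarrow> qfield) \<Rightarrow> 'i \<Rightarrow> 'i qfree set" where
  "Bgen a e X \<tau> ws c s i = cls a e
     (FF i + scal (c i) * theta_free a e X \<tau> ws (FF i * FKb e (sroot i)) * FKb e (- sroot i) +
      scal (s i) * FKb e (- sroot i))"

definition Bcheck :: "('i::{finite, linorder} \<Rightarrow> 'i \<Rightarrow> int) \<Rightarrow> ('i \<Rightarrow> int) \<Rightarrow> 'i set \<Rightarrow>
    ('i \<Rightarrow> 'i) \<Rightarrow> 'i list \<Rightarrow> ('i \<Rightarrow> qfield) \<Rightarrow> ('i \<Rightarrow> qfield) \<Rightarrow> 'i qfree set set" where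
  "Bcheck a e X \<tau> ws c s = subalg a e
     ({Bgen a e X \<tau> ws c s i | i. i \<notin> X} \<union>
      {cls a e (FE i) | i. i \<in> X} \<union>
      {cls a e (FF i) | i. i \<in> X} \<union>
      {Kb a e b | b. b \<in> half_root_lattice \<and> (\<forall>i. i \<notin> X \<longrightarrow> b $ i = 0)} \<union>
      {Kb a e b | b. b \<in> half_root_lattice \<and> Theta a \<tau> ws b = b})"

definition Acheck :: "('i::finite \<Rightarrow> 'i \<Rightarrow> int) \<Rightarrow> ('i \<Rightarrow> int) \<Rightarrow> ('i \<Rightarrow> 'i) \<Rightarrow> 'i list \<Rightarrow>
    'i qfree set set" where
  "Acheck a e \<tau> ws = subalg a e {Kb a e b | b. b \<in> half_root_lattice \<and> Theta a \<tau> ws b = - b}"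

definition BAB :: "('i::{finite, linorder} \<Rightarrow> 'i \<Rightarrow> int) \<Rightarrow> ('i \<Rightarrow> int) \<Rightarrow> 'i set \<Rightarrow>
    ('i \<Rightarrow> 'i) \<Rightarrow> 'i list \<Rightarrow> ('i \<Rightarrow> qfield) \<Rightarrow> ('i \<Rightarrow> qfield) \<Rightarrow> ('i \<Rightarrow> qfield) \<Rightarrow> ('i \<Rightarrow> qfield) \<Rightarrow>
    'i qfree set set" where
  "BAB a e X \<tau> ws c s d t = lin_span a e
     {b \<otimes>\<^bsub>Uq a e\<^esub> x \<otimes>\<^bsub>Uq a e\<^esub> b' | b x b'.
        b \<in> Bcheck a e X \<tau> ws c s \<and> x \<in> Acheck a e \<tau> ws \<and> b' \<in> Bcheck a e X \<tau> ws d t}"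


section \<open>Regular points\<close>

definition mu :: "('i::finite \<Rightarrow> 'i \<Rightarrow> int) \<Rightarrow> ('i \<Rightarrow> 'i) \<Rightarrow> 'i list \<Rightarrow> 'i \<Rightarrow> real ^ 'i" where
  "mu a \<tau> ws i = (1 / 2) *\<^sub>R (sroot i - Theta a \<tau> ws (sroot i))"

definition regular_exponent :: "('i::finite \<Rightarrow> 'i \<Rightarrow> int) \<Rightarrow> ('i \<Rightarrow> int) \<Rightarrow> ('i \<Rightarrow> 'i) \<Rightarrow>
    real ^ 'i \<Rightarrow> 'i list \<Rightarrow> real" where
  "regular_exponent a e \<tau> b vs =
     (\<Sum>i<length vs. form a e b (sroot (vs ! i) + sroot (\<tau> (vs ! i)))) -
     (\<Sum>(i, j) \<in> {(i, j). i < length vs \<and> j < length vs \<and> i \<noteq> j}.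
        form a e (sroot (vs ! i)) (sroot (vs ! j)))"

text \<open>\<open>\<A>\<^sub>r\<^sub>e\<^sub>g(F\<^sub>U)\<close> for \<open>U = us\<close>; subsequences are not required to be contiguous. For
  \<open>us = []\<close> the condition on \<open>\<lambda>\<close> is vacuous.\<close>

definition Areg :: "('i::finite \<Rightarrow> 'i \<Rightarrow> int) \<Rightarrow> ('i \<Rightarrow> int) \<Rightarrow> ('i \<Rightarrow> 'i) \<Rightarrow> 'i list \<Rightarrow>
    ('i \<Rightarrow> qfield) \<Rightarrow> ('i \<Rightarrow> qfield) \<Rightarrow> 'i list \<Rightarrow> 'i qfree set set" where
  "Areg a e \<tau> ws c d us =
     {Kb a e l | l. l \<in> half_root_lattice \<and> Theta a \<tau> ws l = - l \<and>
        (\<forall>k<length us. \<forall>vs. \<forall>N :: nat \<Rightarrow> real.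
           subseq vs us \<and> length vs = length us - k \<and> (\<forall>j<length us. N j \<in> {-1, 0, 1}) \<longrightarrow>
           prod_list (map c vs) / prod_list (map d vs) \<noteq>
           qpow (regular_exponent a e \<tau>
             (l + (\<Sum>j<length us. N j *\<^sub>R mu a \<tau> ws (us ! j))) vs))}"

end

theory Submission
  imports Defs
begin

text \<open>
  The theorem holds because a word \<open>F\<^sub>U\<close> can be rotated cyclically at the cost of a scalar. For
  simple generators, \<open>B\<^sub>i = F\<^sub>i - c\<^sub>i v\<^sub>i E\<^bsub>\<tau>(i)\<^esub> K\<^sub>i\<^sup>-\<^sup>1 + s\<^sub>i K\<^sub>i\<^sup>-\<^sup>1\<close>, and for the second subalgebra
  the same holds with \<open>d\<^sub>i, t\<^sub>i\<close> in place of \<open>c\<^sub>i, s\<^sub>i\<close>. Modulo the span of the products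
  \<open>bab'\<close>, and modulo shorter words, the first letter \<open>F\<^sub>x\<close> of a word can be replaced by
  \<open>c\<^sub>x v\<^sub>x E\<^bsub>\<tau>(x)\<^esub> K\<^sub>x\<^sup>-\<^sup>1\<close>, this commutes with the rest of the word up to a power of \<open>q\<close>, and at the
  end of the word \<open>d\<^sub>x v\<^sub>x E\<^bsub>\<tau>(x)\<^esub> K\<^sub>x\<^sup>-\<^sup>1\<close> can be replaced by \<open>F\<^sub>x\<close> (\<open>rotate_word\<close>). After a full
  rotation the word \<open>F\<^sub>U K\<^sub>\<lambda>\<close> is congruent to \<open>\<kappa> F\<^sub>U K\<^sub>\<lambda>\<close>, where \<open>\<kappa>\<close> is the product of the
  \<open>c\<^sub>x / d\<^sub>x\<close> and a power of \<open>q\<close>. The condition \<open>\<kappa> \<noteq> 1\<close> is the instance of regularity for the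
  full word and \<open>\<mu> = 0\<close>, and it puts \<open>F\<^sub>U K\<^sub>\<lambda>\<close> into the span (\<open>word_in_span\<close>).

  The shorter words are handled by induction on the length. They lack one or two letters of \<open>U\<close>,
  and \<open>\<lambda>\<close> is shifted by \<open>0\<close> or \<open>\<plusminus>\<mu>\<^sub>u\<close> for each removed letter \<open>u\<close>; the remaining instances of
  regularity provide for these. The empty word gives \<open>K\<^sub>\<lambda>\<close>, which lies in the quantum
  torus.

  The shifts have this form because \<open>\<Theta>(\<alpha>\<^sub>u) = -\<alpha>\<^bsub>\<tau>(u)\<^esub>\<close>: then \<open>\<alpha>\<^sub>u\<close> is the sum of \<open>\<mu>\<^sub>u\<close> and
  the vector \<open>(\<alpha>\<^sub>u - \<alpha>\<^bsub>\<tau>(u)\<^esub>) / 2\<close> fixed by \<open>\<Theta>\<close>, whose \<open>K\<close> lies in both subalgebras.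
  This in turn follows from the simplicity of the generators by comparing weights. The element
  \<open>\<theta>\<^sub>q(F\<^sub>i K\<^sub>i)\<close> has weight \<open>w\<^sub>X(\<alpha>\<^bsub>\<tau>(i)\<^esub>)\<close>, since each of Lusztig's automorphisms \<open>T\<^sub>j\<close>
  transforms weights by \<open>r\<^sub>j\<close>; it is a nonzero multiple of \<open>E\<^bsub>\<tau>(i)\<^esub>\<close>, so
  \<open>w\<^sub>X(\<alpha>\<^bsub>\<tau>(i)\<^esub>) = \<alpha>\<^bsub>\<tau>(i)\<^esub>\<close> unless \<open>E\<^bsub>\<tau>(i)\<^esub> = 0\<close> (\<open>simple_root_fixed\<close>). A simple root
  outside \<open>X\<close> that is fixed by \<open>w\<^sub>X\<close> is orthogonal to \<open>X\<close>, and so is its image under \<open>\<tau>\<close>, which is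
  therefore fixed as well. Finally, \<open>E\<^sub>u = 0\<close> implies \<open>F\<^sub>u = 0\<close>, and a word with a vanishing letter
  is trivially in the span.
\<close>

section \<open>Powers of the indeterminate\<close>

lemma qhalf_power: "qhalf ^ n = Fract (Polynomial.monom 1 n) 1"
  by (induction n) (simp_all add: qhalf_def One_fract_def monom_altdef one_pCons)

lemma qhalf_nonzero [simp]: "qhalf \<noteq> 0"
  by (simp add: qhalf_def Zero_fract_def eq_fract)

lemma qhalf_powi_eq_1_iff: "qhalf powi n = 1 \<longleftrightarrow> n = 0"
proof
  assume n: "qhalf powi n = 1"
  then have "qhalf ^ nat \<bar>n\<bar> = 1"
    by (cases "n \<ge> 0") (simp_all add: power_int_def power_inverse)
  then have "Polynomial.monom (1::complex) (nat \<bar>n\<bar>) = 1"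
    by (simp add: qhalf_power One_fract_def eq_fract)
  then have "degree (Polynomial.monom (1::complex) (nat \<bar>n\<bar>)) = 0"
    by (simp only: degree_1)
  then show "n = 0"
    by (simp add: degree_monom_eq)
qed simp

lemma qhalf_powi_inject: "qhalf powi m = qhalf powi n \<longleftrightarrow> m = n"
  using qhalf_powi_eq_1_iff[of "m - n"] by (simp add: power_int_diff)

lemma qpow_eq: "2 * x = of_int n \<Longrightarrow> qpow x = qhalf powi n"
  by (simp add: qpow_def)

lemma qpow_nonzero [simp]: "qpow x \<noteq> 0"
  by (simp add: qpow_def)

lemma qpow_0 [simp]: "qpow 0 = 1"
  by (simp add: qpow_def)

lemma qpow_add:
  assumes "2 * x \<in> \<int>" "2 * y \<in> \<int>"
  shows "qpow (x + y) = qpow x * qpow y"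
proof -
  obtain m n where "2 * x = of_int m" "2 * y = of_int n"
    using assms by (auto elim!: Ints_cases)
  moreover from this have "qpow (x + y) = qhalf powi (m + n)"
    by (intro qpow_eq) simp
  ultimately show ?thesis
    by (simp add: qpow_eq power_int_add)
qed

lemma qpow_minus:
  assumes "2 * x \<in> \<int>"
  shows "qpow (- x) = inverse (qpow x)"
  using qpow_add[of x "- x"] assms by (simp add: field_simps)

lemma qpow_sum_list:
  assumes "\<And>x. x \<in> set xs \<Longrightarrow> 2 * f x \<in> \<int>"
  shows "qpow (sum_list (map f xs)) = prod_list (map (\<lambda>x. qpow (f x)) xs)"
  using assms
proof (induction xs)
  case (Cons x xs)
  have "2 * sum_list (map f xs) \<in> \<int>" if "\<And>x. x \<in> set xs \<Longrightarrow> 2 * f x \<in> \<int>" for xs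
    using that by (induction xs) (auto simp: distrib_left)
  with Cons show ?case
    by (simp add: qpow_add)
qed simp


section \<open>Calculating in the quotient by the relations\<close>

text \<open>Calculations take place in the free algebra, which is a type-class ring; an identity in
  the quantized enveloping algebra is an equation between classes of representatives. The
  congruence rules allow an identity to be used inside a product.\<close>

lemma ideal_rel_ideal: "ideal (rel_ideal a e) qfree_ring"
  unfolding rel_ideal_def
  by (rule ring.genideal_ideal[OF ring_qfree_ring]) (simp add: qfree_ring_def)

lemma ring_Uq: "ring (Uq a e)"
  unfolding Uq_def by (rule ideal.quotient_is_ring[OF ideal_rel_ideal])

lemma cls_alt: "cls a e x = {r + x | r. r \<in> rel_ideal a e}"
  by (auto simp: cls_def a_r_coset_def' qfree_ring_def)

lemma rel_ideal_zero: "0 \<in> rel_ideal a e"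
  and rel_ideal_add: "x \<in> rel_ideal a e \<Longrightarrow> y \<in> rel_ideal a e \<Longrightarrow> x + y \<in> rel_ideal a e"
  and rel_ideal_mult_left: "x \<in> rel_ideal a e \<Longrightarrow> z * x \<in> rel_ideal a e"
proof -
  interpret ideal "rel_ideal a e" qfree_ring
    by (rule ideal_rel_ideal)
  show "0 \<in> rel_ideal a e" "x \<in> rel_ideal a e \<Longrightarrow> y \<in> rel_ideal a e \<Longrightarrow> x + y \<in> rel_ideal a e"
    "x \<in> rel_ideal a e \<Longrightarrow> z * x \<in> rel_ideal a e"
    using additive_subgroup.zero_closed[OF additive_subgroup_axioms]
      additive_subgroup.a_closed[OF additive_subgroup_axioms, of x y] I_l_closed[of x z]
    by (simp_all add: qfree_ring_def)
qed

lemma rel_ideal_uminus: "x \<in> rel_ideal a e \<Longrightarrow> - x \<in> rel_ideal a e"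
  using rel_ideal_mult_left[of x a e "- 1"] by simp

lemma cls_eq_iff: "cls a e x = cls a e y \<longleftrightarrow> x - y \<in> rel_ideal a e"
proof
  assume "cls a e x = cls a e y"
  moreover have "x \<in> cls a e x"
    unfolding cls_alt using rel_ideal_zero[of a e] by force
  ultimately show "x - y \<in> rel_ideal a e"
    by (auto simp: cls_alt)
next
  have sub: "cls a e x \<subseteq> cls a e y" if "x - y \<in> rel_ideal a e" for x y
  proof
    fix z assume "z \<in> cls a e x"
    then obtain r where r: "r \<in> rel_ideal a e" "z = r + x"
      by (auto simp: cls_alt)
    then have "z = (r + (x - y)) + y"
      by simp
    then show "z \<in> cls a e y"
      using rel_ideal_add[OF r(1) that] unfolding cls_alt by blast
  qed
  assume "x - y \<in> rel_ideal a e"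
  moreover from this have "y - x \<in> rel_ideal a e"
    using rel_ideal_uminus by fastforce
  ultimately show "cls a e x = cls a e y"
    using sub by blast
qed

lemma cls_relator: "x - y \<in> relators a e \<Longrightarrow> cls a e x = cls a e y"
  unfolding cls_eq_iff rel_ideal_def
  using ring.genideal_self[OF ring_qfree_ring, of "relators a e"]
  by (auto simp: qfree_ring_def)

lemma cls_mult: "cls a e x \<otimes>\<^bsub>Uq a e\<^esub> cls a e y = cls a e (x * y)"
  using ideal.rcoset_mult_add[OF ideal_rel_ideal, of x y a e]
  by (simp add: Uq_def cls_def FactRing_def) (simp add: qfree_ring_def)

lemma cls_add: "cls a e x \<oplus>\<^bsub>Uq a e\<^esub> cls a e y = cls a e (x + y)"
proof -
  interpret ideal "rel_ideal a e" qfree_ring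
    by (rule ideal_rel_ideal)
  show ?thesis
    using a_rcos_sum[of x y]
    by (simp add: Uq_def cls_def FactRing_def qfree_ring_def)
qed

lemma cls_zero: "\<zero>\<^bsub>Uq a e\<^esub> = cls a e 0"
  by (auto simp: Uq_def FactRing_def cls_alt)

lemma cls_one: "\<one>\<^bsub>Uq a e\<^esub> = cls a e 1"
  by (simp add: Uq_def FactRing_def cls_def) (simp add: qfree_ring_def)

lemma carrier_Uq: "carrier (Uq a e) = range (cls a e)"
  by (auto simp: Uq_def FactRing_def cls_def A_RCOSETS_def' qfree_ring_def)

lemma cls_uminus: "\<ominus>\<^bsub>Uq a e\<^esub> cls a e x = cls a e (- x)"
proof -
  interpret ring "Uq a e"
    by (rule ring_Uq)
  show ?thesis
    by (rule minus_equality) (simp_all only: cls_add cls_zero carrier_Uq rangeI ab_left_minus)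
qed

lemma cls_cong_add: "cls a e x = cls a e x' \<Longrightarrow> cls a e y = cls a e y' \<Longrightarrow> cls a e (x + y) = cls a e (x' + y')"
  by (metis cls_add)

lemma cls_cong_mult: "cls a e x = cls a e x' \<Longrightarrow> cls a e y = cls a e y' \<Longrightarrow> cls a e (x * y) = cls a e (x' * y')"
  by (metis cls_mult)

lemma cls_cong_uminus: "cls a e x = cls a e x' \<Longrightarrow> cls a e (- x) = cls a e (- x')"
  by (metis cls_uminus)

lemma cls_cong_diff: "cls a e x = cls a e x' \<Longrightarrow> cls a e y = cls a e y' \<Longrightarrow> cls a e (x - y) = cls a e (x' - y')"
  using cls_cong_add[OF _ cls_cong_uminus, of a e x x' y y'] by simp

lemma cls_scal_cancel:
  assumes "cls a e (scal c * x) = cls a e 0" "c \<noteq> 0"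
  shows "cls a e x = cls a e 0"
proof -
  have "cls a e (scal (inverse c) * (scal c * x)) = cls a e (scal (inverse c) * 0)"
    using assms(1) by (rule cls_cong_mult[OF refl])
  then show ?thesis
    using assms(2) by (simp add: scal_mult[symmetric] mult.assoc[symmetric])
qed


section \<open>Bilinear form and reflections\<close>

lemma form_add_left: "form a e (b + b') c = form a e b c + form a e b' c"
  by (simp add: form_def distrib_right sum.distrib)

lemma form_add_right: "form a e b (c + c') = form a e b c + form a e b c'"
  by (simp add: form_def distrib_left distrib_right sum.distrib)

lemma form_scale_left: "form a e (x *\<^sub>R b) c = x * form a e b c"
  by (simp add: form_def sum_distrib_left mult.assoc)

lemma form_scale_right: "form a e b (x *\<^sub>R c) = x * form a e b c"
  by (simp add: form_def sum_distrib_left mult.assoc mult.left_commute)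

lemma form_uminus_left: "form a e (- b) c = - form a e b c"
  using form_scale_left[of a e "-1" b c] by simp

lemma form_uminus_right: "form a e b (- c) = - form a e b c"
  using form_scale_right[of a e b "-1" c] by simp

lemma form_diff_left: "form a e (b - b') c = form a e b c - form a e b' c"
  using form_add_left[of a e b "- b'" c] by (simp add: form_uminus_left)

lemma form_diff_right: "form a e b (c - c') = form a e b c - form a e b c'"
  using form_add_right[of a e b c "- c'"] by (simp add: form_uminus_right)

lemma simple_refl_alt: "simple_refl a i b = b - eval_coroot a i b *\<^sub>R sroot i"
  by (simp add: simple_refl_def vec_eq_iff axis_def)

lemma sum_axis: "(\<Sum>j\<in>UNIV. axis i x $ j * f j) = x * f i" for x :: "'r::comm_ring_1"
  by (subst sum.remove[of _ i]) (auto simp: axis_def intro!: sum.neutral)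

lemma form_eval_coroot: "form a e b c = (\<Sum>i\<in>UNIV. b $ i * (of_int (e i) * eval_coroot a i c))"
  unfolding form_def eval_coroot_def by (simp add: sum_distrib_left mult_ac)

lemma form_sroot_left: "form a e (sroot i) c = of_int (e i) * eval_coroot a i c"
  by (simp only: form_eval_coroot sum_axis mult_1)

lemma eval_coroot_sroot: "eval_coroot a i (sroot j) = (of_int (a i j) :: real)"
  by (simp add: eval_coroot_def sum_axis)

lemma eval_coroot_diff: "eval_coroot a i (b - b') = eval_coroot a i b - eval_coroot a i b'"
  by (simp add: eval_coroot_def left_diff_distrib sum_subtractf)

lemma eval_coroot_add: "eval_coroot a i (b + b') = eval_coroot a i b + eval_coroot a i b'"
  by (simp add: eval_coroot_def distrib_right sum.distrib)

lemma eval_coroot_scale: "eval_coroot a i (x *\<^sub>R b) = x * eval_coroot a i b"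
  by (simp add: eval_coroot_def sum_distrib_left mult.assoc)

lemma eval_root_diff: "eval_root a i (b - b') = eval_root a i b - eval_root a i b'"
  by (simp add: eval_root_def left_diff_distrib sum_subtractf)

lemma eval_root_axis: "eval_root a i (axis j x) = x * of_int (a j i)"
  by (simp add: eval_root_def sum_axis)

lemma form_sroot_sroot: "form a e (sroot i) (sroot j) = of_int (e i * a i j)"
  by (simp add: form_sroot_left eval_coroot_sroot)

lemma weyl_Cons: "weyl a (i # ws) b = simple_refl a i (weyl a ws b)"
  and weyl_Nil: "weyl a [] b = b"
  by (simp_all add: weyl_def)

lemma simple_refl_add: "simple_refl a i (b + b') = simple_refl a i b + simple_refl a i b'"
  by (simp add: simple_refl_alt eval_coroot_add scaleR_left_distrib)

lemma simple_refl_scale: "simple_refl a i (x *\<^sub>R b) = x *\<^sub>R simple_refl a i b"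
  by (simp add: simple_refl_alt eval_coroot_scale scaleR_right_diff_distrib)

lemma weyl_add: "weyl a ws (b + b') = weyl a ws b + weyl a ws b'"
  by (induction ws) (simp_all add: weyl_Cons weyl_Nil simple_refl_add)

lemma weyl_scale: "weyl a ws (x *\<^sub>R b) = x *\<^sub>R weyl a ws b"
  by (induction ws) (simp_all add: weyl_Cons weyl_Nil simple_refl_scale)

lemma weyl_fixed:
  "(\<And>j. j \<in> set ws \<Longrightarrow> eval_coroot a j b = 0) \<Longrightarrow> weyl a ws b = b"
  by (induction ws) (simp_all add: weyl_Cons weyl_Nil simple_refl_alt)

lemma weyl_moves_within:
  "k \<notin> set ws \<Longrightarrow> weyl a ws b $ k = b $ k"
  by (induction ws) (simp_all add: weyl_Cons weyl_Nil simple_refl_def axis_def)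

lemma Theta_add: "Theta a \<tau> ws (b + b') = Theta a \<tau> ws b + Theta a \<tau> ws b'"
proof -
  have "permute \<tau> (b + b') = permute \<tau> b + permute \<tau> b'"
    by (simp add: permute_def vec_eq_iff)
  then show ?thesis
    by (simp add: Theta_def weyl_add)
qed

lemma Theta_scale: "Theta a \<tau> ws (x *\<^sub>R b) = x *\<^sub>R Theta a \<tau> ws b"
proof -
  have "permute \<tau> (x *\<^sub>R b) = x *\<^sub>R permute \<tau> b"
    by (simp add: permute_def vec_eq_iff)
  then show ?thesis
    by (simp add: Theta_def weyl_scale)
qed

lemma Theta_diff: "Theta a \<tau> ws (b - b') = Theta a \<tau> ws b - Theta a \<tau> ws b'"
  using Theta_add[of a \<tau> ws b "(- 1) *\<^sub>R b'"] Theta_scale[of a \<tau> ws "- 1" b'] by simp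

lemma Theta_sroot:
  assumes "bij \<tau>"
  shows "Theta a \<tau> ws (sroot i) = - weyl a ws (sroot (\<tau> i))"
proof -
  have "permute \<tau> (sroot i) = sroot (\<tau> i)"
    using assms by (auto simp: permute_def vec_eq_iff axis_def inv_f_f surj_f_inv_f bij_is_inj bij_is_surj)
  then show ?thesis
    by (simp add: Theta_def)
qed

lemma half_root_lattice_add:
  "b \<in> half_root_lattice \<Longrightarrow> b' \<in> half_root_lattice \<Longrightarrow> b + b' \<in> half_root_lattice"
  by (simp add: half_root_lattice_def distrib_left)

lemma half_root_lattice_uminus: "b \<in> half_root_lattice \<Longrightarrow> - b \<in> half_root_lattice"
  by (simp add: half_root_lattice_def)

lemma half_root_lattice_diff:
  "b \<in> half_root_lattice \<Longrightarrow> b' \<in> half_root_lattice \<Longrightarrow> b - b' \<in> half_root_lattice"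
  using half_root_lattice_add[OF _ half_root_lattice_uminus, of b b'] by simp

lemma half_root_lattice_sroot [simp]: "sroot i \<in> half_root_lattice"
  by (simp add: half_root_lattice_def axis_def)

lemma half_root_lattice_zero [simp]: "0 \<in> half_root_lattice"
  by (simp add: half_root_lattice_def)

lemma half_root_lattice_half_sroot [simp]: "(1 / 2) *\<^sub>R sroot i \<in> half_root_lattice"
  by (simp add: half_root_lattice_def axis_def)

text \<open>The natural pairing of the root lattice with the coroot lattice. With the simple roots
  in its first argument it takes integral values, and simple reflections are dual under it to
  simple coreflections.\<close>

definition pairing :: "('i::finite \<Rightarrow> 'i \<Rightarrow> int) \<Rightarrow> real ^ 'i \<Rightarrow> int ^ 'i \<Rightarrow> real" where
  "pairing a b h = (\<Sum>i\<in>UNIV. b $ i * of_int (eval_root a i h))"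

lemma pairing_sroot: "pairing a (sroot i) h = of_int (eval_root a i h)"
  by (simp add: pairing_def sum_axis)

lemma pairing_diff: "pairing a (b - b') h = pairing a b h - pairing a b' h"
  by (simp add: pairing_def left_diff_distrib sum_subtractf)

lemma pairing_simple_coroot: "pairing a b (axis k 1) = eval_coroot a k b"
  by (simp add: pairing_def eval_root_axis eval_coroot_def)

lemma eval_root_simple_corefl:
  "eval_root a j (simple_corefl a i h) = eval_root a j h - eval_root a i h * of_int (a i j)"
  by (simp add: simple_corefl_def eval_root_diff eval_root_axis)

lemma pairing_simple_corefl: "pairing a b (simple_corefl a i h) = pairing a (simple_refl a i b) h"
proof -
  have "pairing a b (simple_corefl a i h) = pairing a b h - eval_coroot a i b * of_int (eval_root a i h)"
    by (simp add: pairing_def eval_coroot_def eval_root_simple_corefl sum_distrib_left sum_distrib_right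
        right_diff_distrib sum_subtractf mult_ac)
  also have "eval_coroot a i b * of_int (eval_root a i h) = pairing a (axis i (eval_coroot a i b)) h"
    by (simp add: pairing_def sum_axis)
  finally show ?thesis
    by (simp add: simple_refl_def pairing_diff)
qed

locale cartan =
  fixes a :: "'i::finite \<Rightarrow> 'i \<Rightarrow> int" and e :: "'i \<Rightarrow> int"
  assumes gcm: "symmetrizable_gcm a e"
begin

lemma a_diag: "a i i = 2" and a_nonpos: "i \<noteq> j \<Longrightarrow> a i j \<le> 0" and e_pos: "e i > 0"
  and symmetrized: "e i * a i j = e j * a j i"
  using gcm by (auto simp: symmetrizable_gcm_def)

lemma form_commute: "form a e b c = form a e c b"
proof -
  have "form a e b c = (\<Sum>j\<in>UNIV. \<Sum>i\<in>UNIV. b $ i * c $ j * of_int (e i * a i j))"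
    unfolding form_def by (rule sum.swap)
  then show ?thesis
    unfolding form_def by (simp only: symmetrized mult.commute)
qed

lemma form_sroot_right: "form a e b (sroot i) = of_int (e i) * eval_coroot a i b"
  using form_commute[of b "sroot i"] by (simp add: form_sroot_left)

lemma form_simple_refl: "form a e (simple_refl a i b) (simple_refl a i c) = form a e b c"
  by (simp add: simple_refl_alt form_diff_left form_diff_right form_scale_left
      form_scale_right form_sroot_left form_sroot_right eval_coroot_sroot a_diag algebra_simps)

lemma form_weyl: "form a e (weyl a ws b) (weyl a ws c) = form a e b c"
  by (induction ws) (simp_all add: weyl_Cons weyl_Nil form_simple_refl)

text \<open>The form is positive definite on the span of \<open>X\<close>, hence a vector of that span that
  pairs to zero with all coroots vanishes; \<open>w\<^sub>X\<beta> - \<beta>\<close> is in that span.\<close>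

lemma weyl_eq_selfI:
  assumes "finite_type a e X" "set ws \<subseteq> X"
    and "\<And>h. pairing a (weyl a ws b) h = pairing a b h"
  shows "weyl a ws b = b"
proof (rule ccontr)
  define z where "z = weyl a ws b - b"
  assume "weyl a ws b \<noteq> b"
  then have "z \<noteq> 0"
    by (simp add: z_def)
  moreover have "z $ i = 0" if "i \<notin> X" for i
    using that assms(2) weyl_moves_within[of i ws a b] by (auto simp: z_def)
  ultimately have "form a e z z > 0"
    using assms(1) by (auto simp: finite_type_def)
  moreover have "eval_coroot a k z = 0" for k
    using assms(3)[of "axis k 1"] by (simp add: z_def pairing_simple_coroot eval_coroot_diff)
  then have "form a e z z = 0"
    by (simp add: form_eval_coroot)
  ultimately show False
    by simp
qed

end


section \<open>Weights\<close>

text \<open>A homogeneous element of the free algebra, with its weight regarded as a function on the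
  coroot lattice. Homogeneity is a notion of the free algebra and not of its quotient because
  the factors of the quantum involution are substitutions of the free algebra.\<close>

inductive homog :: "('i::finite \<Rightarrow> 'i \<Rightarrow> int) \<Rightarrow> (int ^ 'i \<Rightarrow> int) \<Rightarrow> 'i qfree \<Rightarrow> bool" for a where
  homog_E: "homog a (eval_root a i) (FE i)"
| homog_F: "homog a (\<lambda>h. - eval_root a i h) (FF i)"
| homog_K: "homog a (\<lambda>h. 0) (FK m)"
| homog_scal: "homog a (\<lambda>h. 0) (scal x)"
| homog_zero: "homog a \<phi> 0"
| homog_add: "homog a \<phi> x \<Longrightarrow> homog a \<phi> y \<Longrightarrow> homog a \<phi> (x + y)"
| homog_mult: "homog a \<phi> x \<Longrightarrow> homog a \<psi> y \<Longrightarrow> homog a (\<lambda>h. \<phi> h + \<psi> h) (x * y)"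

lemma homog_mult_eq:
  "homog a \<phi> x \<Longrightarrow> homog a \<psi> y \<Longrightarrow> (\<And>h. \<eta> h = \<phi> h + \<psi> h) \<Longrightarrow> homog a \<eta> (x * y)"
  using homog_mult[of a \<phi> x \<psi> y] by presburger

lemma homog_scal_mult: "homog a \<phi> x \<Longrightarrow> homog a \<phi> (scal r * x)"
  by (rule homog_mult_eq[OF homog_scal]) auto

lemma uminus_conv_scal: "- x = scal (- 1) * x"
proof -
  have "scal (- 1) * x + scal 1 * x = 0"
    by (simp only: distrib_right[symmetric] scal_add[symmetric]) simp
  then show ?thesis
    by (simp only: eq_neg_iff_add_eq_0[symmetric] scal_one mult_1)
qed

lemma homog_uminus: "homog a \<phi> x \<Longrightarrow> homog a \<phi> (- x)"
  by (subst uminus_conv_scal) (rule homog_scal_mult)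

lemma homog_sum: "(\<And>r. r \<in> R \<Longrightarrow> homog a \<phi> (f r)) \<Longrightarrow> homog a \<phi> (sum f R)"
  by (induction R rule: infinite_finite_induct) (auto intro: homog.intros)

lemma homog_power: "homog a \<phi> x \<Longrightarrow> homog a (\<lambda>h. int n * \<phi> h) (x ^ n)"
proof (induction n)
  case 0
  then show ?case
    using homog_scal[of a 1] by simp
next
  case (Suc n)
  then show ?case
    by (auto intro!: homog_mult_eq simp: algebra_simps)
qed

lemma homog_divpow: "homog a \<phi> (Z i) \<Longrightarrow> homog a (\<lambda>h. int n * \<phi> h) (divpow e Z i n)"
  unfolding divpow_def by (intro homog_scal_mult homog_power)

lemma homog_Fword:
  "homog a (\<lambda>h. - (\<Sum>u\<leftarrow>us. eval_root a u h)) (prod_list (map FF us))"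
proof (induction us)
  case Nil
  then show ?case
    using homog_scal[of a 1] by simp
next
  case (Cons u us)
  then show ?case
    by (auto intro!: homog_mult_eq homog_F)
qed

lemma K_mult: "cls a e (FK h * FK h') = cls a e (FK (h + h'))"
  by (rule cls_relator) (rule relators.K_add)

lemma homog_commute:
  assumes "homog a \<phi> x"
  shows "cls a e (FK h * x) = cls a e (scal (qhalf powi \<phi> h) * (x * FK h))"
  using assms
proof induction
  case (homog_E i)
  show ?case
    using cls_relator[OF relators.K_E[of h i a e]] by (simp add: mult.assoc)
next
  case (homog_F i)
  show ?case
    using cls_relator[OF relators.K_F[of h i a e]] by (simp add: mult.assoc)
next
  case (homog_K m)
  show ?case
    by (simp add: K_mult add.commute)
next
  case (homog_scal x)
  show ?case
    by (simp add: scal_commute)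
next
  case (homog_add \<phi> x y)
  show ?case
    unfolding distrib_left distrib_right by (rule cls_cong_add[OF homog_add.IH])
next
  case (homog_mult \<phi> x \<psi> y)
  have "cls a e (FK h * (x * y)) = cls a e (scal (qhalf powi \<phi> h) * (x * FK h) * y)"
    using cls_cong_mult[OF homog_mult.IH(1) refl, of y] by (simp add: mult.assoc)
  also have "\<dots> = cls a e ((scal (qhalf powi \<phi> h) * x) * (FK h * y))"
    by (simp add: mult.assoc)
  also have "\<dots> = cls a e ((scal (qhalf powi \<phi> h) * x) * (scal (qhalf powi \<psi> h) * (y * FK h)))"
    by (rule cls_cong_mult[OF refl homog_mult.IH(2)])
  also have "(scal (qhalf powi \<phi> h) * x) * (scal (qhalf powi \<psi> h) * (y * FK h))
    = scal (qhalf powi \<phi> h) * (x * scal (qhalf powi \<psi> h)) * (y * FK h)"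
    by (simp only: mult.assoc)
  also have "\<dots> = scal (qhalf powi \<phi> h) * scal (qhalf powi \<psi> h) * (x * (y * FK h))"
    by (simp only: mult.assoc scal_commute[symmetric, of x])
  also have "\<dots> = scal (qhalf powi (\<phi> h + \<psi> h)) * (x * y * FK h)"
    by (simp add: power_int_add scal_mult mult.assoc)
  finally show ?case .
qed simp

lemma scal_diff: "scal (r - r') = scal r - scal r'"
  using scal_add[of "r - r'" r'] by (metis add_diff_cancel diff_add_cancel)

text \<open>An element of the quotient with two distinct weights is zero, since \<open>q\<^bsup>1/2\<^esup>\<close> is not a
  root of unity.\<close>

lemma homog_unique:
  assumes "homog a \<phi> x" "homog a \<psi> y" "cls a e x = cls a e y" "\<phi> h \<noteq> \<psi> h"
  shows "cls a e y = cls a e 0"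
proof -
  have K_inverse: "cls a e (FK h * FK (- h)) = cls a e 1"
    using K_mult[of a e h "- h"] cls_relator[OF relators.K_zero[of a e]] by simp
  have "cls a e (scal (qhalf powi \<phi> h) * (y * FK h)) = cls a e (scal (qhalf powi \<phi> h) * (x * FK h))"
    using assms(3) by (intro cls_cong_mult) auto
  also have "\<dots> = cls a e (FK h * x)"
    by (rule homog_commute[OF assms(1), symmetric])
  also have "\<dots> = cls a e (FK h * y)"
    using assms(3) by (intro cls_cong_mult) auto
  also have "\<dots> = cls a e (scal (qhalf powi \<psi> h) * (y * FK h))"
    by (rule homog_commute[OF assms(2)])
  finally have "cls a e (scal (qhalf powi \<phi> h - qhalf powi \<psi> h) * (y * FK h)) = cls a e 0"
    by (simp add: cls_eq_iff scal_diff left_diff_distrib)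
  then have "cls a e (y * FK h) = cls a e 0"
    by (rule cls_scal_cancel) (simp add: qhalf_powi_inject assms(4))
  then have "cls a e (y * FK h * FK (- h)) = cls a e (0 * FK (- h))"
    by (rule cls_cong_mult) simp
  moreover have "cls a e (y * FK h * FK (- h)) = cls a e (y * 1)"
    unfolding mult.assoc by (rule cls_cong_mult[OF refl K_inverse])
  ultimately show ?thesis
    by simp
qed

lemma subst_uminus: "subst f (- x) = - subst f x"
proof -
  have "subst f (- x) + subst f x = subst f 0"
    by (simp flip: subst_add)
  then show ?thesis
    by (simp add: subst_def eq_neg_iff_add_eq_0)
qed

lemma homog_subst:
  assumes E: "\<And>i. homog a (\<lambda>h. eval_root a i (\<sigma> h)) (f (GenE i))"
    and F: "\<And>i. homog a (\<lambda>h. - eval_root a i (\<sigma> h)) (f (GenF i))"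
    and K: "\<And>m. homog a (\<lambda>h. 0) (f (GenK m))"
    and x: "homog a \<phi> x"
  shows "homog a (\<lambda>h. \<phi> (\<sigma> h)) (subst f x)"
  using x
proof induction
  case (homog_zero \<phi>)
  then show ?case
    by (simp add: subst_def homog.homog_zero)
qed (auto simp: subst_add subst_mult E F K intro: homog.intros)

context cartan
begin

text \<open>The weights involved are \<open>r\<^sub>i(\<alpha>\<^sub>j) = \<alpha>\<^sub>j - a\<^sub>i\<^sub>j \<alpha>\<^sub>i\<close>: each summand of \<open>T\<^sub>i(E\<^sub>j)\<close> contains
  \<open>-a\<^sub>i\<^sub>j\<close> factors \<open>E\<^sub>i\<close>.\<close>

lemma homog_T:
  assumes "homog a \<phi> x"
  shows "homog a (\<lambda>h. \<phi> (simple_corefl a i h)) (subst (T_gen a e i) x)"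
proof (rule homog_subst[OF _ _ _ assms])
  fix j
  show "homog a (\<lambda>h. eval_root a j (simple_corefl a i h)) (T_gen a e i (GenE j))"
  proof (cases "j = i")
    case True
    then show ?thesis
      by (auto simp: eval_root_simple_corefl a_diag FKb_def
          intro!: homog_uminus homog_mult_eq[OF homog_F homog_K])
  next
    case False
    have "homog a (\<lambda>h. eval_root a j (simple_corefl a i h))
      (scal x * divpow e FE i (nat (- a i j) - r) * FE j * divpow e FE i r)"
      if "r \<le> nat (- a i j)" for r x
      using that False a_nonpos[of i j] unfolding mult.assoc
      by (intro homog_scal_mult homog_mult_eq[OF homog_divpow[OF homog_E]
            homog_mult_eq[OF homog_E homog_divpow[OF homog_E] refl]])
        (auto simp: eval_root_simple_corefl of_nat_diff algebra_simps)
    with False show ?thesis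
      by (auto simp: Let_def intro!: homog_sum)
  qed
  show "homog a (\<lambda>h. - eval_root a j (simple_corefl a i h)) (T_gen a e i (GenF j))"
  proof (cases "j = i")
    case True
    then show ?thesis
      by (auto simp: eval_root_simple_corefl a_diag FKb_def
          intro!: homog_uminus homog_mult_eq[OF homog_K homog_E])
  next
    case False
    have "homog a (\<lambda>h. - eval_root a j (simple_corefl a i h))
      (scal x * divpow e FF i r * FF j * divpow e FF i (nat (- a i j) - r))"
      if "r \<le> nat (- a i j)" for r x
      using that False a_nonpos[of i j] unfolding mult.assoc
      by (intro homog_scal_mult homog_mult_eq[OF homog_divpow[OF homog_F]
            homog_mult_eq[OF homog_F homog_divpow[OF homog_F] refl]])
        (auto simp: eval_root_simple_corefl of_nat_diff algebra_simps)
    with False show ?thesis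
      by (auto simp: Let_def intro!: homog_sum)
  qed
qed (simp add: homog_K)

lemma homog_T_word:
  assumes "homog a \<phi> x" "\<And>h. of_int (\<phi> h) = pairing a b h"
  shows "\<exists>\<psi>. homog a \<psi> (foldr (\<lambda>i f. subst (T_gen a e i) \<circ> f) ws id x) \<and>
    (\<forall>h. of_int (\<psi> h) = pairing a (weyl a ws b) h)"
proof (induction ws)
  case Nil
  then show ?case
    using assms by (auto simp: weyl_Nil)
next
  case (Cons i ws)
  then obtain \<psi> where "homog a \<psi> (foldr (\<lambda>i f. subst (T_gen a e i) \<circ> f) ws id x)"
    "\<And>h. of_int (\<psi> h) = pairing a (weyl a ws b) h"
    by blast
  then have "homog a (\<lambda>h. \<psi> (simple_corefl a i h))
      (subst (T_gen a e i) (foldr (\<lambda>i f. subst (T_gen a e i) \<circ> f) ws id x))"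
    "\<forall>h. of_int (\<psi> (simple_corefl a i h)) = pairing a (weyl a (i # ws) b) h"
    by (simp_all only: homog_T weyl_Cons pairing_simple_corefl[symmetric]) blast
  then show ?case
    by (metis (no_types, lifting) foldr_Cons o_apply)
qed

end

lemma homog_Ad:
  assumes "homog a \<phi> x"
  shows "homog a \<phi> (subst (Ad_gen a X \<tau>) x)"
  using homog_subst[of a "\<lambda>h. h" "Ad_gen a X \<tau>" \<phi> x] assms
  by (simp add: homog_scal_mult homog.intros)

context cartan
begin

text \<open>If \<open>E\<^sub>i = 0\<close>, then \<open>K\<^sub>i = K\<^sub>i\<^sup>-\<^sup>1\<close> because of \<open>[E\<^sub>i, F\<^sub>i]\<close>, so conjugation by
  \<open>K\<^sub>i\<close> multiplies \<open>F\<^sub>i\<close> both by \<open>q\<^sub>i\<^sup>-\<^sup>2\<close> and by \<open>q\<^sub>i\<^sup>2\<close>.\<close>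

lemma E_zero_imp_F_zero:
  assumes "cls a e (FE i) = cls a e 0"
  shows "cls a e (FF i) = cls a e 0"
proof -
  define h :: "int ^ 'i" where "h = axis i (2 * e i)"
  have h: "FKb e (sroot i) = FK h" "FKb e (- sroot i) = FK (- h)"
  proof -
    have [simp]: "\<lfloor>2 * real_of_int n\<rfloor> = 2 * n" "\<lfloor>- (2 * real_of_int n)\<rfloor> = - (2 * n)" for n
      by linarith+
    show "FKb e (sroot i) = FK h" "FKb e (- sroot i) = FK (- h)"
      unfolding FKb_def h_def
      by (intro arg_cong[of _ _ FK]; auto simp: vec_eq_iff axis_def)+
  qed
  define r where "r = 1 / (qi e i - inverse (qi e i))"
  have "qi e i = qhalf powi (2 * e i)"
    by (simp add: qi_def qpow_eq)
  then have "r \<noteq> 0"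
    using qhalf_powi_inject[of "2 * e i" "- (2 * e i)"] e_pos[of i]
    by (simp add: r_def power_int_minus)
  have "cls a e (scal r * (FK h - FK (- h))) = cls a e (FE i * FF i - FF i * FE i)"
    using cls_relator[OF relators.E_F[where i = i and j = i and a = a and e = e]] by (simp add: h r_def)
  also have "\<dots> = cls a e (0 * FF i - FF i * 0)"
    by (rule cls_cong_diff[OF cls_cong_mult[OF assms refl] cls_cong_mult[OF refl assms]])
  also have "0 * FF i - FF i * 0 = (0 :: 'i qfree)"
    by (simp only: mult_zero_left mult_zero_right diff_0_right)
  finally have "cls a e (FK h - FK (- h)) = cls a e 0"
    using \<open>r \<noteq> 0\<close> by (rule cls_scal_cancel)
  then have K: "cls a e (FK h) = cls a e (FK (- h))"
    by (simp only: cls_eq_iff diff_0_right)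
  have "cls a e (scal (qhalf powi (- eval_root a i h)) * (FF i * FK h)) = cls a e (FK h * FF i)"
    by (rule homog_commute[OF homog_F, symmetric])
  also have "\<dots> = cls a e (FK (- h) * FF i)"
    by (intro cls_cong_mult refl K K[symmetric])
  also have "\<dots> = cls a e (scal (qhalf powi (- eval_root a i (- h))) * (FF i * FK (- h)))"
    by (rule homog_commute[OF homog_F])
  also have "\<dots> = cls a e (scal (qhalf powi (- eval_root a i (- h))) * (FF i * FK h))"
    by (intro cls_cong_mult refl K K[symmetric])
  finally have eq: "cls a e (scal (qhalf powi (- eval_root a i h)) * (FF i * FK h))
     = cls a e (scal (qhalf powi (- eval_root a i (- h))) * (FF i * FK h))" .
  have "eval_root a i h = 4 * e i" "eval_root a i (- h) = - 4 * e i"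
    using eval_root_diff[of a i 0 h] by (simp_all add: h_def eval_root_axis a_diag eval_root_def[of _ _ 0])
  then have neq: "qhalf powi (- eval_root a i h) - qhalf powi (- eval_root a i (- h)) \<noteq> 0"
    using e_pos[of i] by (simp add: qhalf_powi_inject)
  have "cls a e (scal (qhalf powi (- eval_root a i h) - qhalf powi (- eval_root a i (- h))) * (FF i * FK h)) = cls a e 0"
    using eq by (simp add: cls_eq_iff scal_diff left_diff_distrib)
  from this neq have "cls a e (FF i * FK h) = cls a e 0"
    by (rule cls_scal_cancel)
  then have "cls a e (FF i * FK h * FK (- h)) = cls a e (0 * FK (- h))"
    by (rule cls_cong_mult) simp
  moreover have "cls a e (FK h * FK (- h)) = cls a e 1"
    using K_mult[of a e h "- h"] cls_relator[OF relators.K_zero[of a e]] by simp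
  then have "cls a e (FF i * FK h * FK (- h)) = cls a e (FF i * 1)"
    unfolding mult.assoc by (rule cls_cong_mult[OF refl])
  ultimately show ?thesis
    by simp
qed

end


section \<open>Simple generators and the involution on roots\<close>

locale admissible = cartan a e for a :: "'i::{finite, linorder} \<Rightarrow> 'i \<Rightarrow> int" and e +
  fixes X :: "'i set" and \<tau> :: "'i \<Rightarrow> 'i" and ws :: "'i list"
  assumes admissible: "admissible_pair a e X \<tau> ws"
begin

lemma fin_type: "finite_type a e X" and ws_subset: "set ws \<subseteq> X" and bij_\<tau>: "bij \<tau>"
  and a_\<tau>: "a (\<tau> i) (\<tau> j) = a i j" and \<tau>_in_X_iff: "\<tau> i \<in> X \<longleftrightarrow> i \<in> X" and \<tau>_\<tau>: "\<tau> (\<tau> i) = i"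
  and weyl_X: "j \<in> X \<Longrightarrow> weyl a ws (sroot j) = - sroot (\<tau> j)"
proof -
  note adm = admissible[unfolded admissible_pair_def reduced_word_of_longest_def reduced_word_def]
  show "finite_type a e X" "set ws \<subseteq> X" "bij \<tau>" "a (\<tau> i) (\<tau> j) = a i j"
    using adm by auto
  show \<tau>: "\<tau> (\<tau> i) = i" for i
    using adm by (simp add: fun_eq_iff)
  show "\<tau> i \<in> X \<longleftrightarrow> i \<in> X"
    using adm \<tau> by (metis imageI)
  show "j \<in> X \<Longrightarrow> weyl a ws (sroot j) = - sroot (\<tau> j)"
    using adm by (metis minus_minus)
qed

text \<open>If \<open>w\<^sub>X\<close> fixes \<open>\<alpha>\<^sub>i\<close>, then invariance of the form under \<open>w\<^sub>X\<close> gives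
  \<open>(\<alpha>\<^sub>j, \<alpha>\<^sub>i) = - (\<alpha>\<^bsub>\<tau>(j)\<^esub>, \<alpha>\<^sub>i)\<close> for \<open>j \<in> X\<close>; the two sides have opposite signs.\<close>

lemma orthogonal_of_fixed:
  assumes "i \<notin> X" "weyl a ws (sroot i) = sroot i" "j \<in> X"
  shows "a j i = 0"
proof -
  have "form a e (sroot j) (sroot i) = form a e (- sroot (\<tau> j)) (sroot i)"
    using form_weyl[of ws "sroot j" "sroot i"] assms weyl_X[of j] by simp
  then have "e j * a j i = - (e (\<tau> j) * a (\<tau> j) i)"
    by (simp only: form_uminus_left form_sroot_sroot)
  moreover have "j \<noteq> i" "\<tau> j \<noteq> i"
    using assms \<tau>_in_X_iff[of j] by auto
  then have "e j * a j i \<le> 0" "e (\<tau> j) * a (\<tau> j) i \<le> 0"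
    using a_nonpos[of j i] a_nonpos[of "\<tau> j" i] e_pos[of j] e_pos[of "\<tau> j"]
    by (simp_all add: mult_le_0_iff)
  ultimately have "e j * a j i = 0"
    by linarith
  then show ?thesis
    using e_pos[of j] by simp
qed

text \<open>Diagram automorphisms carry the orthogonality of \<open>\<alpha>\<^sub>i\<close> to \<open>X\<close> over to \<open>\<alpha>\<^bsub>\<tau>(i)\<^esub>\<close>.\<close>

lemma fixed_\<tau>:
  assumes "i \<notin> X" "weyl a ws (sroot i) = sroot i"
  shows "weyl a ws (sroot (\<tau> i)) = sroot (\<tau> i)"
proof (rule weyl_fixed)
  fix j assume "j \<in> set ws"
  then have "\<tau> j \<in> X"
    using ws_subset \<tau>_in_X_iff by auto
  then have "a (\<tau> j) i = 0"
    using orthogonal_of_fixed[OF assms] by simp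
  then show "eval_coroot a j (sroot (\<tau> i)) = 0"
    using a_\<tau>[of "\<tau> j" i] by (simp add: eval_coroot_sroot \<tau>_\<tau>)
qed

lemma Theta_of_fixed:
  assumes "i \<notin> X" "weyl a ws (sroot i) = sroot i"
  shows "Theta a \<tau> ws (sroot i) = - sroot (\<tau> i)" "Theta a \<tau> ws (sroot (\<tau> i)) = - sroot i"
  using assms fixed_\<tau>[OF assms] by (simp_all add: Theta_sroot[OF bij_\<tau>] \<tau>_\<tau>)

lemma homog_theta:
  "\<exists>\<phi>. homog a \<phi> (theta_free a e X \<tau> ws (FF i * FKb e b)) \<and>
    (\<forall>h. of_int (\<phi> h) = pairing a (weyl a ws (sroot (\<tau> i))) h)"
proof -
  define x where "x = subst (psi_gen e) (subst (tau_gen \<tau>) (subst omega_gen (FF i * FKb e b)))"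
  have "homog a (eval_root a (\<tau> i)) x"
    by (auto simp: x_def FKb_def subst_mult subst_uminus
        intro!: homog_uminus homog_mult_eq[OF homog_mult_eq[OF homog_E homog_K refl] homog_K])
  then obtain \<psi> where "homog a \<psi> (foldr (\<lambda>i f. subst (T_gen a e i) \<circ> f) ws id x)"
    "\<forall>h. of_int (\<psi> h) = pairing a (weyl a ws (sroot (\<tau> i))) h"
    using homog_T_word[of "eval_root a (\<tau> i)" x "sroot (\<tau> i)" ws] by (auto simp: pairing_sroot)
  then show ?thesis
    unfolding theta_free_def x_def o_apply using homog_Ad by blast
qed

text \<open>The element \<open>\<theta>\<^sub>q(F\<^sub>j K\<^sub>j)\<close>, for \<open>j = \<tau>(i)\<close>, has weight \<open>w\<^sub>X(\<alpha>\<^sub>i)\<close>, and for a pair with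
  simple generators it is a multiple of \<open>E\<^sub>i\<close>, of weight \<open>\<alpha>\<^sub>i\<close>. If \<open>E\<^sub>i \<noteq> 0\<close>, then the weights
  agree on the coroot lattice.\<close>

lemma simple_root_fixed:
  assumes sg: "simple_generators a e X \<tau> ws" and i: "i \<notin> X" and nz: "cls a e (FF i) \<noteq> cls a e 0"
  shows "weyl a ws (sroot i) = sroot i"
proof (rule weyl_eq_selfI[OF fin_type ws_subset])
  have "\<tau> i \<notin> X"
    using i \<tau>_in_X_iff by simp
  then obtain v where "v \<noteq> 0" and v: "cls a e (theta_free a e X \<tau> ws (FF (\<tau> i) * FKb e (sroot (\<tau> i))))
      = cls a e (- (scal v * FE i))"
    using sg \<tau>_\<tau>[of i] unfolding simple_generators_def by metis
  obtain \<phi> where \<phi>: "homog a \<phi> (theta_free a e X \<tau> ws (FF (\<tau> i) * FKb e (sroot (\<tau> i))))"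
    "\<And>h. of_int (\<phi> h) = pairing a (weyl a ws (sroot i)) h"
    using homog_theta[of "\<tau> i" "sroot (\<tau> i)"] \<tau>_\<tau>[of i] by metis
  have E: "homog a (eval_root a i) (- (scal v * FE i))"
    by (intro homog_uminus homog_scal_mult homog_E)
  have "\<phi> h = eval_root a i h" for h
  proof (rule ccontr)
    assume "\<phi> h \<noteq> eval_root a i h"
    then have "cls a e (- (scal v * FE i)) = cls a e 0"
      using homog_unique[OF \<phi>(1) E v] by simp
    moreover have "- (scal v * FE i) = scal (- v) * FE i"
      by (simp only: uminus_conv_scal[of "scal v * FE i"] mult.assoc[symmetric] scal_mult[symmetric]) simp
    ultimately have "cls a e (FE i) = cls a e 0"
      using cls_scal_cancel[of a e "- v" "FE i"] \<open>v \<noteq> 0\<close> by simp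
    then show False
      using E_zero_imp_F_zero nz by blast
  qed
  then show "pairing a (weyl a ws (sroot i)) h = pairing a (sroot i) h" for h
    using \<phi>(2)[of h] by (simp add: pairing_sroot)
qed

end


section \<open>Spans of products\<close>

lemma subalg_subset: "S \<subseteq> carrier (Uq a e) \<Longrightarrow> subalg a e S \<subseteq> carrier (Uq a e)"
  unfolding subalg_def by (rule ring.generate_ring_incl[OF ring_Uq]) (auto simp: carrier_Uq)

lemma subalg_generator: "x \<in> S \<Longrightarrow> x \<in> subalg a e S"
  unfolding subalg_def by (rule generate_ring.incl) simp

lemma subalg_one: "cls a e 1 \<in> subalg a e S"
  using generate_ring.one[of "Uq a e"] by (simp add: subalg_def cls_one)

lemma subalg_mult: "x \<in> subalg a e S \<Longrightarrow> y \<in> subalg a e S \<Longrightarrow> x \<otimes>\<^bsub>Uq a e\<^esub> y \<in> subalg a e S"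
  unfolding subalg_def by (rule generate_ring.eng_mult)

lemma lin_span_subset:
  assumes "S \<subseteq> carrier (Uq a e)"
  shows "lin_span a e S \<subseteq> carrier (Uq a e)"
proof
  interpret ring "Uq a e"
    by (rule ring_Uq)
  fix x assume "x \<in> lin_span a e S"
  then show "x \<in> carrier (Uq a e)"
    by induction (use assms in \<open>auto simp: carrier_Uq[symmetric] intro!: add.m_closed m_closed\<close>,
        auto simp: carrier_Uq)
qed

lemma lin_span_add:
  assumes S: "S \<subseteq> carrier (Uq a e)" and x: "x \<in> lin_span a e S" and y: "y \<in> lin_span a e S"
  shows "x \<oplus>\<^bsub>Uq a e\<^esub> y \<in> lin_span a e S"
proof -
  interpret ring "Uq a e"
    by (rule ring_Uq)
  have scal: "cls a e (scal r) \<in> carrier (Uq a e)" for r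
    by (simp add: carrier_Uq)
  have y': "y \<in> carrier (Uq a e)"
    using S y lin_span_subset by blast
  show ?thesis
    using x
  proof induction
    case zero
    then show ?case
      using y y' by simp
  next
    case (step x z r)
    then have "x \<in> carrier (Uq a e)" "z \<in> carrier (Uq a e)"
      using S lin_span_subset by blast+
    then show ?case
      using lin_span.step[OF step(1,3), of r] y' by (simp add: a_assoc scal)
  qed
qed

text \<open>The common part of three closure properties. For multiplication by a scalar, \<open>f\<close> changes the
  coefficients by \<open>g\<close> and leaves the elements of \<open>S\<close> alone; for multiplication by an element of
  the algebra, \<open>f\<close> changes the elements of \<open>S\<close> by \<open>h\<close> and leaves the coefficients alone.\<close>

lemma lin_span_map:
  assumes S: "S \<subseteq> carrier (Uq a e)" and x: "x \<in> lin_span a e S"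
    and f0: "f \<zero>\<^bsub>Uq a e\<^esub> = \<zero>\<^bsub>Uq a e\<^esub>"
    and f: "\<And>r x y. x \<in> carrier (Uq a e) \<Longrightarrow> y \<in> carrier (Uq a e) \<Longrightarrow>
      f ((cls a e (scal r) \<otimes>\<^bsub>Uq a e\<^esub> x) \<oplus>\<^bsub>Uq a e\<^esub> y) = (cls a e (scal (g r)) \<otimes>\<^bsub>Uq a e\<^esub> h x) \<oplus>\<^bsub>Uq a e\<^esub> f y"
    and h: "\<And>x. x \<in> S \<Longrightarrow> h x \<in> S"
  shows "f x \<in> lin_span a e S"
  using x
proof induction
  case zero
  then show ?case
    by (simp add: f0 lin_span.zero)
next
  case (step x y r)
  then have "x \<in> carrier (Uq a e)" "y \<in> carrier (Uq a e)"
    using S lin_span_subset[OF S] by blast+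
  then show ?case
    by (simp only: f) (intro lin_span.step h step)
qed

lemma lin_span_scal:
  assumes "S \<subseteq> carrier (Uq a e)" "x \<in> lin_span a e S"
  shows "cls a e (scal r) \<otimes>\<^bsub>Uq a e\<^esub> x \<in> lin_span a e S"
proof (rule lin_span_map[where g = "\<lambda>r'. r * r'" and h = "\<lambda>x. x", OF assms])
  show "cls a e (scal r) \<otimes>\<^bsub>Uq a e\<^esub> \<zero>\<^bsub>Uq a e\<^esub> = \<zero>\<^bsub>Uq a e\<^esub>"
    by (simp add: cls_zero cls_mult)
qed (auto simp: carrier_Uq cls_mult cls_add distrib_left scal_mult mult.assoc)

lemma lin_span_mult_left:
  assumes "S \<subseteq> carrier (Uq a e)" "x \<in> lin_span a e S" "b \<in> carrier (Uq a e)"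
    and "\<And>x. x \<in> S \<Longrightarrow> b \<otimes>\<^bsub>Uq a e\<^esub> x \<in> S"
  shows "b \<otimes>\<^bsub>Uq a e\<^esub> x \<in> lin_span a e S"
proof (rule lin_span_map[where g = "\<lambda>r. r" and h = "\<lambda>x. b \<otimes>\<^bsub>Uq a e\<^esub> x", OF assms(1,2) _ _ assms(4)])
  obtain b' where b: "b = cls a e b'"
    using assms(3) by (auto simp: carrier_Uq)
  show "b \<otimes>\<^bsub>Uq a e\<^esub> \<zero>\<^bsub>Uq a e\<^esub> = \<zero>\<^bsub>Uq a e\<^esub>"
    by (simp add: b cls_zero cls_mult)
  fix r x y
  assume "x \<in> carrier (Uq a e)" "y \<in> carrier (Uq a e)"
  then obtain x' y' where xy: "x = cls a e x'" "y = cls a e y'"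
    by (auto simp: carrier_Uq)
  have "b' * (scal r * x' + y') = scal r * (b' * x') + b' * y'"
    by (simp only: distrib_left mult.assoc[symmetric] scal_commute[symmetric, of b'])
  then show "b \<otimes>\<^bsub>Uq a e\<^esub> ((cls a e (scal r) \<otimes>\<^bsub>Uq a e\<^esub> x) \<oplus>\<^bsub>Uq a e\<^esub> y)
      = (cls a e (scal r) \<otimes>\<^bsub>Uq a e\<^esub> (b \<otimes>\<^bsub>Uq a e\<^esub> x)) \<oplus>\<^bsub>Uq a e\<^esub> (b \<otimes>\<^bsub>Uq a e\<^esub> y)"
    by (simp only: b xy cls_add cls_mult)
qed

lemma lin_span_mult_right:
  assumes "S \<subseteq> carrier (Uq a e)" "x \<in> lin_span a e S" "b \<in> carrier (Uq a e)"
    and "\<And>x. x \<in> S \<Longrightarrow> x \<otimes>\<^bsub>Uq a e\<^esub> b \<in> S"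
  shows "x \<otimes>\<^bsub>Uq a e\<^esub> b \<in> lin_span a e S"
proof (rule lin_span_map[where g = "\<lambda>r. r" and h = "\<lambda>x. x \<otimes>\<^bsub>Uq a e\<^esub> b", OF assms(1,2) _ _ assms(4)])
  show "\<zero>\<^bsub>Uq a e\<^esub> \<otimes>\<^bsub>Uq a e\<^esub> b = \<zero>\<^bsub>Uq a e\<^esub>"
    using assms(3) by (auto simp: carrier_Uq cls_zero cls_mult)
qed (use assms(3) in \<open>auto simp: carrier_Uq cls_mult cls_add distrib_right mult.assoc\<close>)


section \<open>Straightening modulo the span of products\<close>

text \<open>Two coideal subalgebras of the same pair, with a choice of the scalars \<open>v\<^sub>i\<close> that express
  \<open>\<theta>\<^sub>q(F\<^sub>i K\<^sub>i)\<close> by \<open>E\<^bsub>\<tau>(i)\<^esub>\<close>. The same \<open>v\<^sub>i\<close> occurs in the generators of both, and so it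
  cancels from all conditions below.\<close>

locale coideal_pair = admissible a e X \<tau> ws for a :: "'i::{finite, linorder} \<Rightarrow> 'i \<Rightarrow> int" and e X \<tau> ws +
  fixes c d s t v :: "'i \<Rightarrow> qfield"
  assumes v_nonzero: "i \<notin> X \<Longrightarrow> v i \<noteq> 0"
    and theta_simple: "i \<notin> X \<Longrightarrow>
      cls a e (theta_free a e X \<tau> ws (FF i * FKb e (sroot i))) = cls a e (- (scal (v i) * FE (\<tau> i)))"
    and d_nonzero: "i \<notin> X \<Longrightarrow> d i \<noteq> 0"
begin

text \<open>A predicate on representatives, so that the arithmetic of the free algebra applies. The set
  it describes is a subspace that is stable under the first subalgebra on the left and under the
  second on the right.\<close>

definition in_BAB :: "'i qfree \<Rightarrow> bool" where
  "in_BAB x \<longleftrightarrow> cls a e x \<in> BAB a e X \<tau> ws c s d t"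

abbreviation Fw :: "'i list \<Rightarrow> 'i qfree" where "Fw us \<equiv> prod_list (map FF us)"

abbreviation products :: "'i qfree set set" where
  "products \<equiv> {b \<otimes>\<^bsub>Uq a e\<^esub> x \<otimes>\<^bsub>Uq a e\<^esub> b' | b x b'.
     b \<in> Bcheck a e X \<tau> ws c s \<and> x \<in> Acheck a e \<tau> ws \<and> b' \<in> Bcheck a e X \<tau> ws d t}"

lemma Acheck_carrier: "Acheck a e \<tau> ws \<subseteq> carrier (Uq a e)"
  unfolding Acheck_def by (rule subalg_subset) (auto simp: carrier_Uq Kb_def)

lemma Bcheck_carrier: "Bcheck a e X \<tau> ws c' s' \<subseteq> carrier (Uq a e)"
  unfolding Bcheck_def
  by (rule subalg_subset) (auto simp: carrier_Uq Bgen_def Kb_def)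

lemma products_carrier:
  "products \<subseteq> carrier (Uq a e)"
proof -
  interpret ring "Uq a e"
    by (rule ring_Uq)
  show ?thesis
    using Acheck_carrier Bcheck_carrier[of c s] Bcheck_carrier[of d t] by blast
qed

lemma in_BAB_cong: "cls a e x = cls a e y \<Longrightarrow> in_BAB x \<longleftrightarrow> in_BAB y"
  by (simp add: in_BAB_def)

lemma in_BAB_zero: "in_BAB 0"
  using lin_span.zero[of a e] by (simp add: in_BAB_def BAB_def cls_zero)

lemma in_BAB_add: "in_BAB x \<Longrightarrow> in_BAB y \<Longrightarrow> in_BAB (x + y)"
  unfolding in_BAB_def BAB_def cls_add[symmetric] by (rule lin_span_add[OF products_carrier])

lemma in_BAB_scal: "in_BAB x \<Longrightarrow> in_BAB (scal r * x)"
  unfolding in_BAB_def BAB_def cls_mult[symmetric] by (rule lin_span_scal[OF products_carrier])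

lemma in_BAB_uminus: "in_BAB x \<Longrightarrow> in_BAB (- x)"
  by (subst uminus_conv_scal) (rule in_BAB_scal)

lemma in_BAB_diff: "in_BAB x \<Longrightarrow> in_BAB y \<Longrightarrow> in_BAB (x - y)"
  using in_BAB_add[OF _ in_BAB_uminus, of x y] by (simp only: diff_conv_add_uminus)

lemma in_BAB_scal_cancel:
  assumes "in_BAB (scal r * x)" "r \<noteq> 0"
  shows "in_BAB x"
proof -
  have "in_BAB (scal (inverse r) * (scal r * x))"
    using assms(1) by (rule in_BAB_scal)
  then show ?thesis
    using assms(2) by (simp add: mult.assoc[symmetric] scal_mult[symmetric])
qed

lemma in_BAB_left:
  assumes "cls a e b \<in> Bcheck a e X \<tau> ws c s" "in_BAB x"
  shows "in_BAB (b * x)"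
proof -
  interpret ring "Uq a e"
    by (rule ring_Uq)
  note carr = Acheck_carrier Bcheck_carrier[of c s] Bcheck_carrier[of d t]
  show ?thesis
    unfolding in_BAB_def BAB_def cls_mult[symmetric]
  proof (rule lin_span_mult_left[OF products_carrier])
    fix y
    assume "y \<in> products"
    then obtain b1 x1 b2 where y: "y = b1 \<otimes>\<^bsub>Uq a e\<^esub> x1 \<otimes>\<^bsub>Uq a e\<^esub> b2"
      "b1 \<in> Bcheck a e X \<tau> ws c s" "x1 \<in> Acheck a e \<tau> ws" "b2 \<in> Bcheck a e X \<tau> ws d t"
      by blast
    then have "cls a e b \<otimes>\<^bsub>Uq a e\<^esub> y = (cls a e b \<otimes>\<^bsub>Uq a e\<^esub> b1) \<otimes>\<^bsub>Uq a e\<^esub> x1 \<otimes>\<^bsub>Uq a e\<^esub> b2"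
      using carr assms(1) by (simp add: m_assoc subset_iff)
    moreover have "cls a e b \<otimes>\<^bsub>Uq a e\<^esub> b1 \<in> Bcheck a e X \<tau> ws c s"
      using assms(1) y(2) unfolding Bcheck_def by (rule subalg_mult)
    ultimately show "cls a e b \<otimes>\<^bsub>Uq a e\<^esub> y \<in> products"
      using y by blast
  qed (use assms(2) carr assms(1) in \<open>auto simp: in_BAB_def BAB_def\<close>)
qed

lemma in_BAB_right:
  assumes "cls a e b \<in> Bcheck a e X \<tau> ws d t" "in_BAB x"
  shows "in_BAB (x * b)"
proof -
  interpret ring "Uq a e"
    by (rule ring_Uq)
  note carr = Acheck_carrier Bcheck_carrier[of c s] Bcheck_carrier[of d t]
  show ?thesis
    unfolding in_BAB_def BAB_def cls_mult[symmetric]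
  proof (rule lin_span_mult_right[OF products_carrier])
    fix y
    assume "y \<in> products"
    then obtain b1 x1 b2 where y: "y = b1 \<otimes>\<^bsub>Uq a e\<^esub> x1 \<otimes>\<^bsub>Uq a e\<^esub> b2"
      "b1 \<in> Bcheck a e X \<tau> ws c s" "x1 \<in> Acheck a e \<tau> ws" "b2 \<in> Bcheck a e X \<tau> ws d t"
      by blast
    then have "y \<otimes>\<^bsub>Uq a e\<^esub> cls a e b = b1 \<otimes>\<^bsub>Uq a e\<^esub> x1 \<otimes>\<^bsub>Uq a e\<^esub> (b2 \<otimes>\<^bsub>Uq a e\<^esub> cls a e b)"
      using carr assms(1) by (simp add: m_assoc subset_iff)
    moreover have "b2 \<otimes>\<^bsub>Uq a e\<^esub> cls a e b \<in> Bcheck a e X \<tau> ws d t"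
      using y(4) assms(1) unfolding Bcheck_def by (rule subalg_mult)
    ultimately show "y \<otimes>\<^bsub>Uq a e\<^esub> cls a e b \<in> products"
      using y by blast
  qed (use assms(2) carr assms(1) in \<open>auto simp: in_BAB_def BAB_def\<close>)
qed

lemma in_BAB_K:
  assumes "b \<in> half_root_lattice" "Theta a \<tau> ws b = - b"
  shows "in_BAB (FKb e b)"
proof -
  have "cls a e (FKb e b) \<in> Acheck a e \<tau> ws"
    unfolding Acheck_def Kb_def by (rule subalg_generator) (use assms in blast)
  moreover have "cls a e 1 \<in> Bcheck a e X \<tau> ws c' s'" for c' s'
    unfolding Bcheck_def by (rule subalg_one)
  ultimately have "cls a e 1 \<otimes>\<^bsub>Uq a e\<^esub> cls a e (FKb e b) \<otimes>\<^bsub>Uq a e\<^esub> cls a e 1 \<in>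
      products"
    by blast
  from lin_span.step[where a = a and e = e and c = 1, OF this lin_span.zero] show ?thesis
    by (simp add: in_BAB_def BAB_def cls_mult cls_add cls_zero)
qed

text \<open>This is where simple generators enter: \<open>B\<^sub>i = F\<^sub>i - c\<^sub>i v\<^sub>i E\<^bsub>\<tau>(i)\<^esub> K\<^sub>i\<^sup>-\<^sup>1 + s\<^sub>i K\<^sub>i\<^sup>-\<^sup>1\<close>.\<close>

lemma B_mem:
  assumes "i \<notin> X"
  shows "cls a e (FF i - scal (c' i * v i) * (FE (\<tau> i) * FKb e (- sroot i)) + scal (s' i) * FKb e (- sroot i))
    \<in> Bcheck a e X \<tau> ws c' s'" (is "cls a e ?B \<in> _")
proof -
  have "cls a e (scal (c' i) * theta_free a e X \<tau> ws (FF i * FKb e (sroot i)) * FKb e (- sroot i))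
     = cls a e (scal (c' i) * (- (scal (v i) * FE (\<tau> i))) * FKb e (- sroot i))"
    by (intro cls_cong_mult refl theta_simple assms)
  also have "scal (c' i) * (- (scal (v i) * FE (\<tau> i))) * FKb e (- sroot i)
     = - (scal (c' i * v i) * (FE (\<tau> i) * FKb e (- sroot i)))"
    by (simp only: scal_mult mult.assoc mult_minus_left mult_minus_right)
  finally have "Bgen a e X \<tau> ws c' s' i
    = cls a e (FF i + - (scal (c' i * v i) * (FE (\<tau> i) * FKb e (- sroot i))) + scal (s' i) * FKb e (- sroot i))"
    unfolding Bgen_def by (intro cls_cong_add refl)
  then have "cls a e ?B = Bgen a e X \<tau> ws c' s' i"
    by (simp only: diff_conv_add_uminus)
  then show ?thesis
    unfolding Bcheck_def using assms by (intro subalg_generator) blast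
qed

lemma K_mem:
  assumes "b \<in> half_root_lattice" "Theta a \<tau> ws b = b"
  shows "cls a e (FKb e b) \<in> Bcheck a e X \<tau> ws c' s'"
  unfolding Bcheck_def Kb_def by (rule subalg_generator) (use assms in blast)

lemma Kb_exponent:
  assumes "b \<in> half_root_lattice"
  shows "of_int \<lfloor>2 * (b $ i * of_int (e i))\<rfloor> = 2 * (b $ i * of_int (e i))"
proof -
  have "2 * b $ i \<in> \<int>"
    using assms by (simp add: half_root_lattice_def)
  then have "2 * b $ i * of_int (e i) \<in> \<int>"
    by (rule Ints_mult) simp
  then obtain n where "2 * (b $ i * of_int (e i)) = of_int n"
    by (auto simp: mult.assoc elim: Ints_cases)
  then show ?thesis
    by (simp only: floor_of_int)
qed

lemma Kb_mult:
  assumes "b \<in> half_root_lattice" "b' \<in> half_root_lattice"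
  shows "cls a e (FKb e b * FKb e b') = cls a e (FKb e (b + b'))"
proof -
  have "\<lfloor>2 * (b $ i * of_int (e i))\<rfloor> + \<lfloor>2 * (b' $ i * of_int (e i))\<rfloor>
    = \<lfloor>2 * ((b + b') $ i * of_int (e i))\<rfloor>" for i
  proof -
    have "real_of_int (\<lfloor>2 * (b $ i * of_int (e i))\<rfloor> + \<lfloor>2 * (b' $ i * of_int (e i))\<rfloor>)
      = real_of_int \<lfloor>2 * ((b + b') $ i * of_int (e i))\<rfloor>"
      unfolding of_int_add Kb_exponent[OF assms(1)] Kb_exponent[OF assms(2)]
        Kb_exponent[OF half_root_lattice_add[OF assms]]
      by (simp add: algebra_simps)
    then show ?thesis
      by (simp only: of_int_eq_iff)
  qed
  then show ?thesis
    unfolding FKb_def K_mult by (simp add: plus_vec_def)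
qed

lemma eval_root_Kb:
  assumes "b \<in> half_root_lattice"
  shows "of_int (eval_root a i (\<chi> k. \<lfloor>2 * (b $ k * of_int (e k))\<rfloor>)) = 2 * form a e b (sroot i)"
proof -
  have "of_int (eval_root a i (\<chi> k. \<lfloor>2 * (b $ k * of_int (e k))\<rfloor>))
    = (\<Sum>j\<in>UNIV. 2 * (b $ j * (of_int (e j) * of_int (a j i))))"
    by (simp add: eval_root_def Kb_exponent[OF assms] mult.assoc)
  also have "\<dots> = 2 * form a e b (sroot i)"
    by (simp add: form_eval_coroot eval_coroot_sroot sum_distrib_left)
  finally show ?thesis .
qed

lemma form_half_integral:
  assumes "b \<in> half_root_lattice"
  shows "2 * form a e b (sroot i) \<in> \<int>"
  using eval_root_Kb[OF assms, of i] by (metis Ints_of_int)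

lemma Kb_commute:
  assumes "b \<in> half_root_lattice" "homog a \<phi> x"
    and "of_int (\<phi> (\<chi> k. \<lfloor>2 * (b $ k * of_int (e k))\<rfloor>)) = 2 * r"
  shows "cls a e (FKb e b * x) = cls a e (scal (qpow r) * (x * FKb e b))"
  using homog_commute[OF assms(2)] qpow_eq[OF assms(3)[symmetric]] by (simp add: FKb_def)

lemma Kb_E:
  assumes "b \<in> half_root_lattice"
  shows "cls a e (FKb e b * FE i) = cls a e (scal (qpow (form a e b (sroot i))) * (FE i * FKb e b))"
  by (rule Kb_commute[OF assms homog_E eval_root_Kb[OF assms]])

lemma Kb_F:
  assumes "b \<in> half_root_lattice"
  shows "cls a e (FKb e b * FF i) = cls a e (scal (qpow (- form a e b (sroot i))) * (FF i * FKb e b))"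
  by (rule Kb_commute[OF assms homog_F]) (simp add: eval_root_Kb[OF assms])

lemma Kb_Fw:
  assumes "b \<in> half_root_lattice"
  shows "cls a e (FKb e b * Fw us) = cls a e (scal (qpow (- (\<Sum>u\<leftarrow>us. form a e b (sroot u)))) * (Fw us * FKb e b))"
proof (rule Kb_commute[OF assms homog_Fword])
  show "of_int (- (\<Sum>u\<leftarrow>us. eval_root a u (\<chi> k. \<lfloor>2 * (b $ k * of_int (e k))\<rfloor>)))
    = 2 * - (\<Sum>u\<leftarrow>us. form a e b (sroot u))"
    by (induction us) (simp_all add: eval_root_Kb[OF assms])
qed

lemma in_BAB_Kb_mid:
  assumes "b \<in> half_root_lattice" "l \<in> half_root_lattice" and in_BAB: "in_BAB (Fw (xs @ ys) * FKb e (b + l))"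
  shows "in_BAB (Fw xs * (FKb e b * (Fw ys * FKb e l)))"
proof -
  define r where "r = qpow (- (\<Sum>u\<leftarrow>ys. form a e b (sroot u)))"
  have "cls a e (Fw xs * (FKb e b * Fw ys * FKb e l)) = cls a e (Fw xs * (scal r * (Fw ys * FKb e b) * FKb e l))"
    unfolding r_def by (intro cls_cong_mult refl Kb_Fw assms)
  also have "Fw xs * (scal r * (Fw ys * FKb e b) * FKb e l) = scal r * ((Fw xs * Fw ys) * (FKb e b * FKb e l))"
    by (simp only: mult.assoc[symmetric] scal_commute[symmetric, of "Fw xs"])
  also have "cls a e \<dots> = cls a e (scal r * ((Fw xs * Fw ys) * FKb e (b + l)))"
    by (intro cls_cong_mult refl Kb_mult assms)
  finally have "cls a e (Fw xs * (FKb e b * (Fw ys * FKb e l))) = cls a e (scal r * (Fw (xs @ ys) * FKb e (b + l)))"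
    by (simp only: mult.assoc map_append prod_list.append)
  then show ?thesis
    using in_BAB_scal[OF in_BAB, of r] in_BAB_cong by blast
qed

text \<open>A power \<open>K\<^sub>\<nu>\<close> with \<open>\<Theta>(\<nu>) = \<nu>\<close> at the right end is absorbed by the right-hand subalgebra.\<close>

lemma in_BAB_absorb:
  assumes "l \<in> half_root_lattice" "n \<in> half_root_lattice" "Theta a \<tau> ws n = n" "in_BAB (x * FKb e l)"
  shows "in_BAB (x * FKb e (l + n))"
proof -
  have "cls a e (x * (FKb e l * FKb e n)) = cls a e (x * FKb e (l + n))"
    by (intro cls_cong_mult refl Kb_mult assms)
  moreover have "in_BAB (x * FKb e l * FKb e n)"
    by (rule in_BAB_right[OF K_mem assms(4)]) (use assms in auto)
  ultimately show ?thesis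
    unfolding mult.assoc using in_BAB_cong by blast
qed

text \<open>Moving \<open>E\<^sub>j\<close> to the right past a word in the \<open>F\<^sub>p\<close> produces, at each letter \<open>p = j\<close>, a term
  in which that letter is replaced by \<open>K\<^sub>j - K\<^sub>j\<^sup>-\<^sup>1\<close>.\<close>

lemma in_BAB_move_E:
  assumes "\<And>ys zs b. W = ys @ j # zs \<Longrightarrow> b \<in> {sroot j, - sroot j} \<Longrightarrow>
    in_BAB (Fw (xs @ ys) * (FKb e b * (Fw zs * y)))"
  shows "in_BAB (Fw xs * (FE j * (Fw W * y)) - Fw xs * (Fw W * (FE j * y)))"
  using assms
proof (induction W arbitrary: xs)
  case Nil
  show ?case
    using in_BAB_zero by simp
next
  case (Cons p W)
  define D where "D = (if j = p then scal (1 / (qi e j - inverse (qi e j))) * (FKb e (sroot j) - FKb e (- sroot j)) else 0)"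
  have "cls a e (FE j * FF p - FF p * FE j) = cls a e D"
    unfolding D_def by (rule cls_relator[OF relators.E_F])
  then have "cls a e (FE j * FF p) = cls a e (FF p * FE j + D)"
    by (simp only: cls_eq_iff diff_diff_eq[symmetric])
  then have "cls a e (Fw xs * ((FE j * FF p) * (Fw W * y))) = cls a e (Fw xs * ((FF p * FE j + D) * (Fw W * y)))"
    by (intro cls_cong_mult refl)
  then have "cls a e (Fw xs * (FE j * (Fw (p # W) * y)) - Fw xs * (Fw (p # W) * (FE j * y)))
     = cls a e (Fw xs * ((FF p * FE j + D) * (Fw W * y)) - Fw xs * (Fw (p # W) * (FE j * y)))"
    by (intro cls_cong_diff refl) (simp only: mult.assoc list.map prod_list.Cons)
  also have "Fw xs * ((FF p * FE j + D) * (Fw W * y)) - Fw xs * (Fw (p # W) * (FE j * y))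
     = (Fw (xs @ [p]) * (FE j * (Fw W * y)) - Fw (xs @ [p]) * (Fw W * (FE j * y))) + Fw xs * (D * (Fw W * y))"
    by (simp add: distrib_left distrib_right mult.assoc)
  finally have eq: "cls a e (Fw xs * (FE j * (Fw (p # W) * y)) - Fw xs * (Fw (p # W) * (FE j * y))) = cls a e \<dots>" .
  have "in_BAB (Fw xs * (D * (Fw W * y)))"
  proof (cases "j = p")
    case True
    have "in_BAB (Fw xs * (FKb e b * (Fw W * y)))" if "b \<in> {sroot j, - sroot j}" for b
      using Cons.prems[of "[]" W b] that True by simp
    then have "in_BAB (scal (1 / (qi e j - inverse (qi e j))) *
        (Fw xs * (FKb e (sroot j) * (Fw W * y)) - Fw xs * (FKb e (- sroot j) * (Fw W * y))))"
      by (intro in_BAB_scal in_BAB_diff) blast+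
    also have "scal (1 / (qi e j - inverse (qi e j))) *
        (Fw xs * (FKb e (sroot j) * (Fw W * y)) - Fw xs * (FKb e (- sroot j) * (Fw W * y)))
      = Fw xs * (D * (Fw W * y))"
      unfolding D_def if_P[OF True]
      by (simp only: right_diff_distrib[symmetric] left_diff_distrib[symmetric] mult.assoc[symmetric]
          scal_commute[symmetric, of "Fw xs"])
    finally show ?thesis .
  next
    case False
    then show ?thesis
      using in_BAB_zero by (simp add: D_def)
  qed
  moreover have "in_BAB (Fw (xs @ [p]) * (FE j * (Fw W * y)) - Fw (xs @ [p]) * (Fw W * (FE j * y)))"
  proof (rule Cons.IH)
    fix ys zs b
    assume "W = ys @ j # zs" "b \<in> {sroot j, - sroot j}"
    then show "in_BAB (Fw ((xs @ [p]) @ ys) * (FKb e b * (Fw zs * y)))"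
      using Cons.prems[of "p # ys" zs b] by simp
  qed
  ultimately show ?case
    unfolding in_BAB_cong[OF eq] by (intro in_BAB_add)
qed

text \<open>The linear algebra of a rotation: \<open>P\<close> and \<open>Z\<close> are a word and its rotation, \<open>Q\<close> and \<open>R\<close>
  are the words with an \<open>E\<close> at the front and at the back.\<close>

lemma in_BAB_combine:
  assumes "in_BAB (P - scal g1 * Q)" "in_BAB (Q - R)" "in_BAB (scal g2 * Z - scal g3 * R)" "g3 \<noteq> 0"
  shows "in_BAB (P - scal (g1 * g2 / g3) * Z)"
proof -
  have "in_BAB ((P - scal g1 * Q) + scal g1 * (Q - R) - scal (g1 / g3) * (scal g2 * Z - scal g3 * R))"
    by (intro in_BAB_add in_BAB_diff[of "_ + _"] in_BAB_scal assms)
  also have "(P - scal g1 * Q) + scal g1 * (Q - R) - scal (g1 / g3) * (scal g2 * Z - scal g3 * R)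
     = P - scal (g1 / g3 * g2) * Z + (scal (g1 / g3 * g3) * R - scal g1 * R)"
    by (simp only: right_diff_distrib mult.assoc[symmetric] scal_mult[symmetric]) (simp only: algebra_simps)
  also have "\<dots> = P - scal (g1 * g2 / g3) * Z"
    using assms(4) by simp
  finally show ?thesis .
qed

lemma mu_eq:
  assumes "x \<notin> X" "weyl a ws (sroot x) = sroot x"
  shows "mu a \<tau> ws x = (1 / 2) *\<^sub>R (sroot x + sroot (\<tau> x))"
    "mu a \<tau> ws (\<tau> x) = (1 / 2) *\<^sub>R (sroot x + sroot (\<tau> x))"
  by (simp_all add: mu_def Theta_of_fixed[OF assms] \<tau>_\<tau> add.commute)

text \<open>Modulo the span, a word \<open>F\<^sub>x W K\<^sub>\<lambda>\<close> is a multiple of its rotation \<open>W F\<^sub>x K\<^sub>\<lambda>\<close>. Multiplying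
  \<open>W K\<^sub>\<lambda>\<close> by \<open>B\<^sub>x\<close> on the left trades \<open>F\<^sub>x\<close> at the front for \<open>E\<^bsub>\<tau>(x)\<^esub>\<close>; this is moved past
  \<open>W\<close>; multiplying \<open>W K\<^sub>\<lambda>\<close> by the generator of the second subalgebra on the right trades
  \<open>E\<^bsub>\<tau>(x)\<^esub>\<close> for \<open>F\<^sub>x\<close> at the end. The hypotheses say that the shorter words that arise on the
  way are in the span: the terms with \<open>s\<^sub>x\<close> and \<open>t\<^sub>x\<close> have lost \<open>x\<close> and shifted \<open>\<lambda>\<close> by
  \<open>-\<mu>\<^sub>x\<close>, the commutators have also lost one letter \<open>\<tau>(x)\<close> and shifted \<open>\<lambda>\<close> by
  \<open>\<plusminus>\<mu>\<^bsub>\<tau>(x)\<^esub>\<close>.\<close>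

lemma rotate_word:
  assumes x: "x \<notin> X" "weyl a ws (sroot x) = sroot x" and l: "l \<in> half_root_lattice"
    and W0: "in_BAB (Fw W * FKb e l)" and W1: "in_BAB (Fw W * FKb e (l - mu a \<tau> ws x))"
    and W2: "\<And>ys zs n. W = ys @ \<tau> x # zs \<Longrightarrow> n \<in> {- 1, 1} \<Longrightarrow>
      in_BAB (Fw (ys @ zs) * FKb e (l - mu a \<tau> ws x + n *\<^sub>R mu a \<tau> ws (\<tau> x)))"
  shows "in_BAB (Fw (x # W) * FKb e l - scal (c x / d x * qpow ((\<Sum>u\<leftarrow>W. form a e (sroot x) (sroot u))
    - form a e l (sroot x + sroot (\<tau> x)))) * (Fw (W @ [x]) * FKb e l))"
proof -
  let ?\<alpha> = "sroot x" and ?\<alpha>' = "sroot (\<tau> x)" and ?K = "FKb e" and ?E = "FE (\<tau> x)"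
  define \<mu> where "\<mu> = mu a \<tau> ws x"
  \<comment> \<open>The decomposition of \<open>\<alpha>\<^sub>x\<close> into its anti-invariant part \<open>\<mu>\<close> and its invariant part \<open>\<nu>\<close>; the
    latter is absorbed by the subalgebras, so only \<open>\<mu>\<close> shifts \<open>\<lambda>\<close>.\<close>
  define \<nu> where "\<nu> = (1 / 2) *\<^sub>R (?\<alpha> - ?\<alpha>')"
  note \<mu>_eq = mu_eq(1)[OF x, folded \<mu>_def] and \<mu>'_eq = mu_eq(2)[OF x, folded mu_eq(1)[OF x] \<mu>_def]
  have \<mu>\<nu>: "?\<alpha> = \<mu> + \<nu>" "?\<alpha>' = \<mu> - \<nu>"
    by (simp_all add: \<mu>_eq \<nu>_def vec_eq_iff field_simps)
  have \<mu>_lattice: "\<mu> \<in> half_root_lattice"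
    unfolding \<mu>_eq scaleR_right_distrib by (intro half_root_lattice_add half_root_lattice_half_sroot)
  have \<nu>_lattice: "\<nu> \<in> half_root_lattice"
    unfolding \<nu>_def scaleR_right_diff_distrib by (intro half_root_lattice_diff half_root_lattice_half_sroot)
  have \<nu>_fixed: "Theta a \<tau> ws \<nu> = \<nu>"
    by (simp add: \<nu>_def Theta_scale Theta_diff Theta_of_fixed[OF x])
  have \<nu>_mult: "r *\<^sub>R \<nu> \<in> half_root_lattice" "Theta a \<tau> ws (r *\<^sub>R \<nu>) = r *\<^sub>R \<nu>" if "r \<in> {- 2, - 1, 0}" for r
    using that half_root_lattice_uminus[OF \<nu>_lattice] half_root_lattice_add[OF half_root_lattice_uminus half_root_lattice_uminus, OF \<nu>_lattice \<nu>_lattice]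
    by (auto simp: Theta_scale \<nu>_fixed scaleR_2)
  have lat: "l - ?\<alpha> \<in> half_root_lattice" "- ?\<alpha> \<in> half_root_lattice" "l - \<mu> \<in> half_root_lattice"
    by (intro half_root_lattice_diff half_root_lattice_uminus l \<mu>_lattice half_root_lattice_sroot)+
  define g1 where "g1 = c x * v x * qpow (\<Sum>u\<leftarrow>W. form a e ?\<alpha> (sroot u))"
  define g2 where "g2 = qpow (- form a e l ?\<alpha>)"
  define g3 where "g3 = d x * v x * qpow (form a e l ?\<alpha>')"

  have lower: "in_BAB (Fw W * ?K (l - ?\<alpha>))"
  proof -
    have "l - ?\<alpha> = (l - \<mu>) + (- 1) *\<^sub>R \<nu>"
      by (simp add: \<mu>\<nu>)
    moreover have "in_BAB (Fw W * ?K ((l - \<mu>) + (- 1) *\<^sub>R \<nu>))"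
      by (rule in_BAB_absorb[OF lat(3) \<nu>_mult]) (use W1 in \<open>simp_all add: \<mu>_def\<close>)
    ultimately show ?thesis
      by (simp only:)
  qed

  \<comment> \<open>\<open>F\<^sub>x\<close> at the front becomes \<open>E\<^bsub>\<tau>(x)\<^esub>\<close>.\<close>
  have 1: "in_BAB (Fw (x # W) * ?K l - scal g1 * (?E * (Fw W * ?K (l - ?\<alpha>))))"
  proof -
    have "in_BAB ((FF x - scal (c x * v x) * (?E * ?K (- ?\<alpha>)) + scal (s x) * ?K (- ?\<alpha>)) * (Fw W * ?K l))"
      by (rule in_BAB_left[OF B_mem[OF x(1)] W0])
    moreover have "in_BAB (scal (s x) * (?K (- ?\<alpha>) * (Fw W * ?K l)))"
      using in_BAB_Kb_mid[of "- ?\<alpha>" l "[]" W] lower lat l by (intro in_BAB_scal) simp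
    ultimately have "in_BAB ((FF x - scal (c x * v x) * (?E * ?K (- ?\<alpha>)) + scal (s x) * ?K (- ?\<alpha>)) * (Fw W * ?K l)
       - scal (s x) * (?K (- ?\<alpha>) * (Fw W * ?K l)))"
      by (rule in_BAB_diff)
    also have "(FF x - scal (c x * v x) * (?E * ?K (- ?\<alpha>)) + scal (s x) * ?K (- ?\<alpha>)) * (Fw W * ?K l)
       - scal (s x) * (?K (- ?\<alpha>) * (Fw W * ?K l))
       = Fw (x # W) * ?K l - scal (c x * v x) * (?E * ((?K (- ?\<alpha>) * Fw W) * ?K l))"
      by (simp add: distrib_right left_diff_distrib mult.assoc)
    finally have *: "in_BAB \<dots>" .
    define r where "r = qpow (\<Sum>u\<leftarrow>W. form a e ?\<alpha> (sroot u))"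
    have "- (\<Sum>u\<leftarrow>W. form a e (- ?\<alpha>) (sroot u)) = (\<Sum>u\<leftarrow>W. form a e ?\<alpha> (sroot u))"
      by (induction W) (simp_all add: form_uminus_left)
    then have KW: "cls a e (?K (- ?\<alpha>) * Fw W) = cls a e (scal r * (Fw W * ?K (- ?\<alpha>)))"
      using Kb_Fw[OF lat(2), of W] by (simp only: r_def)
    have "cls a e (scal (c x * v x) * (?E * ((?K (- ?\<alpha>) * Fw W) * ?K l)))
      = cls a e (scal (c x * v x) * (?E * (scal r * (Fw W * ?K (- ?\<alpha>)) * ?K l)))"
      by (rule cls_cong_mult[OF refl cls_cong_mult[OF refl cls_cong_mult[OF KW refl]]])
    also have "scal (c x * v x) * (?E * (scal r * (Fw W * ?K (- ?\<alpha>)) * ?K l))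
      = scal g1 * (?E * (Fw W * (?K (- ?\<alpha>) * ?K l)))"
      unfolding g1_def r_def[symmetric] scal_mult[of _ r]
      by (simp only: mult.assoc[symmetric] scal_commute[symmetric, of ?E])
    also have "cls a e \<dots> = cls a e (scal g1 * (?E * (Fw W * ?K (l - ?\<alpha>))))"
      using Kb_mult[OF lat(2) l] by (intro cls_cong_mult refl) simp
    finally have "cls a e (Fw (x # W) * ?K l - scal (c x * v x) * (?E * ((?K (- ?\<alpha>) * Fw W) * ?K l)))
      = cls a e (Fw (x # W) * ?K l - scal g1 * (?E * (Fw W * ?K (l - ?\<alpha>))))"
      by (rule cls_cong_diff[OF refl])
    with * show ?thesis
      using in_BAB_cong by blast
  qed

  \<comment> \<open>\<open>E\<^bsub>\<tau>(x)\<^esub>\<close> moves to the end.\<close>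
  have 2: "in_BAB (?E * (Fw W * ?K (l - ?\<alpha>)) - Fw W * (?E * ?K (l - ?\<alpha>)))"
  proof -
    have "in_BAB (Fw ([] @ ys) * (?K b * (Fw zs * ?K (l - ?\<alpha>))))"
      if W: "W = ys @ \<tau> x # zs" and b: "b \<in> {?\<alpha>', - ?\<alpha>'}" for ys zs b
    proof -
      obtain n where n: "n \<in> {- 1, 1}" "b = n *\<^sub>R ?\<alpha>'"
        using b by force
      have "b + (l - ?\<alpha>) = (l - \<mu> + n *\<^sub>R \<mu>) + (- 1 - n) *\<^sub>R \<nu>"
        by (simp add: n \<mu>\<nu> algebra_simps)
      moreover have "- 1 - n \<in> {- 2, - 1, 0}"
        using n by auto
      moreover have "l - \<mu> + n *\<^sub>R \<mu> \<in> half_root_lattice"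
        using n(1) half_root_lattice_add[OF lat(3) \<mu>_lattice] half_root_lattice_diff[OF lat(3) \<mu>_lattice]
        by (elim insertE) simp_all
      moreover have "b \<in> half_root_lattice"
        using b half_root_lattice_uminus[OF half_root_lattice_sroot] by (elim insertE) simp_all
      moreover have "in_BAB (Fw (ys @ zs) * ?K (l - \<mu> + n *\<^sub>R \<mu>))"
        using W2[OF W n(1)] by (simp only: \<mu>'_eq \<mu>_def)
      ultimately have "in_BAB (Fw (ys @ zs) * ?K (b + (l - ?\<alpha>)))"
        using in_BAB_absorb[of "l - \<mu> + n *\<^sub>R \<mu>" "(- 1 - n) *\<^sub>R \<nu>" "Fw (ys @ zs)"] \<nu>_mult[of "- 1 - n"] by presburger
      then show ?thesis
        using in_BAB_Kb_mid[OF \<open>b \<in> half_root_lattice\<close> lat(1), of ys zs] by (simp only: append_Nil)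
    qed
    from in_BAB_move_E[OF this] show ?thesis
      by simp
  qed

  \<comment> \<open>\<open>E\<^bsub>\<tau>(x)\<^esub>\<close> at the end becomes \<open>F\<^sub>x\<close>.\<close>
  have 3: "in_BAB (scal g2 * (Fw (W @ [x]) * ?K l) - scal g3 * (Fw W * (?E * ?K (l - ?\<alpha>))))"
  proof -
    have Kl: "cls a e (Fw W * (?K l * ?K (- ?\<alpha>))) = cls a e (Fw W * ?K (l - ?\<alpha>))"
      using Kb_mult[OF l lat(2)] by (intro cls_cong_mult refl) simp
    have "in_BAB (Fw W * ?K l * (FF x - scal (d x * v x) * (?E * ?K (- ?\<alpha>)) + scal (t x) * ?K (- ?\<alpha>)))"
      by (rule in_BAB_right[OF B_mem[OF x(1)] W0])
    moreover have "in_BAB (scal (t x) * (Fw W * (?K l * ?K (- ?\<alpha>))))"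
      using lower in_BAB_cong[OF Kl] by (intro in_BAB_scal) simp
    ultimately have "in_BAB (Fw W * ?K l * (FF x - scal (d x * v x) * (?E * ?K (- ?\<alpha>)) + scal (t x) * ?K (- ?\<alpha>))
       - scal (t x) * (Fw W * (?K l * ?K (- ?\<alpha>))))"
      by (rule in_BAB_diff)
    also have "Fw W * ?K l * (FF x - scal (d x * v x) * (?E * ?K (- ?\<alpha>)) + scal (t x) * ?K (- ?\<alpha>))
       - scal (t x) * (Fw W * (?K l * ?K (- ?\<alpha>)))
       = Fw W * (?K l * FF x) - scal (d x * v x) * (Fw W * ((?K l * ?E) * ?K (- ?\<alpha>)))"
      by (simp add: distrib_left right_diff_distrib mult.assoc[symmetric] scal_commute[symmetric, of "Fw W * ?K l"])
    finally have *: "in_BAB \<dots>" .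
    have "cls a e (Fw W * (?K l * FF x)) = cls a e (Fw W * (scal g2 * (FF x * ?K l)))"
      unfolding g2_def by (intro cls_cong_mult refl Kb_F l)
    also have "Fw W * (scal g2 * (FF x * ?K l)) = scal g2 * (Fw (W @ [x]) * ?K l)"
      by (simp only: mult.assoc[symmetric] scal_commute[symmetric, of "Fw W"] map_append prod_list.append
          list.map prod_list.Cons prod_list.Nil mult_1_right)
    finally have F: "cls a e (Fw W * (?K l * FF x)) = cls a e (scal g2 * (Fw (W @ [x]) * ?K l))" .
    define r where "r = qpow (form a e l ?\<alpha>')"
    have "cls a e (scal (d x * v x) * (Fw W * ((?K l * ?E) * ?K (- ?\<alpha>))))
      = cls a e (scal (d x * v x) * (Fw W * ((scal r * (?E * ?K l)) * ?K (- ?\<alpha>))))"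
      unfolding r_def by (intro cls_cong_mult refl Kb_E l)
    also have "scal (d x * v x) * (Fw W * ((scal r * (?E * ?K l)) * ?K (- ?\<alpha>)))
      = scal g3 * (Fw W * (?E * (?K l * ?K (- ?\<alpha>))))"
      unfolding g3_def r_def[symmetric] scal_mult[of _ r]
      by (simp only: mult.assoc[symmetric] scal_commute[symmetric, of "Fw W"])
    also have "cls a e \<dots> = cls a e (scal g3 * (Fw W * (?E * ?K (l - ?\<alpha>))))"
      using Kb_mult[OF l lat(2)] by (intro cls_cong_mult refl) simp
    finally have E: "cls a e (scal (d x * v x) * (Fw W * ((?K l * ?E) * ?K (- ?\<alpha>))))
      = cls a e (scal g3 * (Fw W * (?E * ?K (l - ?\<alpha>))))" .
    from * show ?thesis
      using in_BAB_cong[OF cls_cong_diff[OF F E]] by blast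
  qed

  have "g3 \<noteq> 0"
    using d_nonzero[OF x(1)] v_nonzero[OF x(1)] by (simp add: g3_def)
  note in_BAB_combine[OF 1 2 3 this]
  moreover have "g1 * g2 / g3 = c x / d x * qpow ((\<Sum>u\<leftarrow>W. form a e ?\<alpha> (sroot u)) - form a e l (?\<alpha> + ?\<alpha>'))"
  proof -
    have int: "2 * form a e l ?\<alpha> \<in> \<int>" "2 * form a e l ?\<alpha>' \<in> \<int>"
      by (rule form_half_integral[OF l])+
    have sum_int: "2 * (\<Sum>u\<leftarrow>W. form a e ?\<alpha> (sroot u)) \<in> \<int>"
      by (induction W) (auto simp: distrib_left form_sroot_sroot)
    have "qpow ((\<Sum>u\<leftarrow>W. form a e ?\<alpha> (sroot u)) - form a e l (?\<alpha> + ?\<alpha>'))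
      = qpow ((\<Sum>u\<leftarrow>W. form a e ?\<alpha> (sroot u)) + (- form a e l ?\<alpha> + - form a e l ?\<alpha>'))"
      by (simp add: form_add_right algebra_simps)
    also have "\<dots> = qpow (\<Sum>u\<leftarrow>W. form a e ?\<alpha> (sroot u)) * (qpow (- form a e l ?\<alpha>) * inverse (qpow (form a e l ?\<alpha>')))"
    proof -
      have "2 * (- form a e l ?\<alpha> + - form a e l ?\<alpha>') \<in> \<int>"
        using Ints_minus[OF Ints_add[OF int]] by (simp add: algebra_simps)
      then have "qpow ((\<Sum>u\<leftarrow>W. form a e ?\<alpha> (sroot u)) + (- form a e l ?\<alpha> + - form a e l ?\<alpha>'))
        = qpow (\<Sum>u\<leftarrow>W. form a e ?\<alpha> (sroot u)) * qpow (- form a e l ?\<alpha> + - form a e l ?\<alpha>')"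
        by (rule qpow_add[OF sum_int])
      also have "qpow (- form a e l ?\<alpha> + - form a e l ?\<alpha>') = qpow (- form a e l ?\<alpha>) * qpow (- form a e l ?\<alpha>')"
        by (rule qpow_add) (use Ints_minus[OF int(1)] Ints_minus[OF int(2)] in simp_all)
      finally show ?thesis
        by (simp only: qpow_minus[OF int(2)])
    qed
    finally show ?thesis
      unfolding g1_def g2_def g3_def using v_nonzero[OF x(1)] d_nonzero[OF x(1)]
      by (simp only:) (simp add: field_simps)
  qed
  ultimately show ?thesis
    by simp
qed

section \<open>Words at regular points\<close>

text \<open>The exponent of the regularity condition, in a form that visibly depends only on the
  multiset of letters of the word.\<close>

definition resonance_exponent :: "'i multiset \<Rightarrow> (real, 'i) vec \<Rightarrow> real" where
  "resonance_exponent A l = (\<Sum>x\<in>#A. form a e l (sroot x + sroot (\<tau> x))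
     - ((\<Sum>u\<in>#A. form a e (sroot x) (sroot u)) - form a e (sroot x) (sroot x)))"

lemma regular_exponent_eq: "regular_exponent a e \<tau> l vs = resonance_exponent (mset vs) l"
proof -
  let ?n = "length vs" and ?f = "\<lambda>i j. form a e (sroot (vs ! i)) (sroot (vs ! j))"
  have "(\<Sum>(i, j) \<in> {(i, j). i < ?n \<and> j < ?n \<and> i \<noteq> j}. ?f i j)
      = (\<Sum>(i, j) \<in> (SIGMA i:{..<?n}. {..<?n} - {i}). ?f i j)"
    by (rule sum.cong) auto
  also have "\<dots> = (\<Sum>i<?n. \<Sum>j\<in>{..<?n} - {i}. ?f i j)"
    by (rule sum.Sigma[symmetric]) auto
  also have "\<dots> = (\<Sum>i<?n. (\<Sum>j<?n. ?f i j) - ?f i i)"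
    by (intro sum.cong refl) (simp add: sum_diff1)
  finally have eq: "(\<Sum>(i, j) \<in> {(i, j). i < ?n \<and> j < ?n \<and> i \<noteq> j}. ?f i j)
      = (\<Sum>i<?n. (\<Sum>j<?n. ?f i j) - ?f i i)" .
  have sum: "(\<Sum>x\<in>#mset vs. f x) = (\<Sum>i<?n. f (vs ! i))" for f :: "'i \<Rightarrow> real"
    by (simp only: mset_map[symmetric] sum_mset_sum_list) (simp add: sum_list_sum_nth atLeast0LessThan)
  show ?thesis
    unfolding regular_exponent_def resonance_exponent_def eq sum by (simp add: sum_subtractf)
qed

text \<open>Rotating a word letter by letter until it returns to itself shows that a multiple of the
  word by \<open>1 - \<kappa>\<close> is in the span, where \<open>\<kappa>\<close> is the product of all factors picked up, and
  \<open>\<kappa> = 1\<close> is exactly the excluded resonance. The argument is an induction on the length, and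
  the shorter words that arise come with shifted \<open>\<lambda>\<close> and, since the word has been rotated, with
  their letters in another order. Regularity is therefore abstracted to a predicate \<open>R\<close> on the
  multiset of letters and \<open>\<lambda>\<close> that survives the removal of a letter.\<close>

lemma word_in_span:
  fixes R :: "'i multiset \<Rightarrow> (real, 'i) vec \<Rightarrow> bool"
  assumes lattice: "\<And>A l. R A l \<Longrightarrow> l \<in> half_root_lattice \<and> Theta a \<tau> ws l = - l"
    and hereditary: "\<And>A x l n. R (add_mset x A) l \<Longrightarrow> n \<in> {- 1, 0, 1} \<Longrightarrow> R A (l + n *\<^sub>R mu a \<tau> ws x)"
    and nonresonant: "\<And>A l. R A l \<Longrightarrow> A \<noteq> {#} \<Longrightarrow>
      (\<Prod>x\<in>#A. c x / d x) \<noteq> qpow (resonance_exponent A l)"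
    and letters: "\<And>A l x. R A l \<Longrightarrow> x \<in># A \<Longrightarrow> x \<notin> X \<and> weyl a ws (sroot x) = sroot x"
  shows "R (mset us) l \<Longrightarrow> in_BAB (Fw us * FKb e l)"
proof (induction "length us" arbitrary: us l rule: less_induct)
  case less
  note l = lattice[OF less.prems]
  show ?case
  proof (cases "us = []")
    case True
    then show ?thesis
      using in_BAB_K[of l] l by simp
  next
    case False
    \<comment> \<open>The exponent of \<open>q\<close> picked up when the letter \<open>x\<close> is rotated. The other letters of the word
      are the same at every stage, so it does not depend on the stage.\<close>
    define \<rho> where "\<rho> x = (\<Sum>u\<in>#mset us. form a e (sroot x) (sroot u)) - form a e (sroot x) (sroot x)
      - form a e l (sroot x + sroot (\<tau> x))" for x
    define \<kappa> where "\<kappa> xs = prod_list (map (\<lambda>x. c x / d x * qpow (\<rho> x)) xs)" for xs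
    have rotate: "in_BAB (Fw (xs @ ys) * FKb e l - scal (\<kappa> xs) * (Fw (ys @ xs) * FKb e l))"
      if "mset (xs @ ys) = mset us" for xs ys
      using that
    proof (induction xs arbitrary: ys)
      case Nil
      then show ?case
        using in_BAB_zero by (simp add: \<kappa>_def)
    next
      case (Cons x xs)
      let ?W = "xs @ ys"
      have us: "mset us = add_mset x (mset ?W)"
        using Cons.prems by simp
      have len: "length us = Suc (length ?W)"
        using us by (metis size_add_mset size_mset)
      have R: "R (mset ?W) (l + n *\<^sub>R mu a \<tau> ws x)" if "n \<in> {- 1, 0, 1}" for n
        using hereditary[OF less.prems[unfolded us] that] .
      have step: "in_BAB (Fw (x # ?W) * FKb e l - scal (c x / d x * qpow ((\<Sum>u\<leftarrow>?W. form a e (sroot x) (sroot u))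
        - form a e l (sroot x + sroot (\<tau> x)))) * (Fw (?W @ [x]) * FKb e l))"
      proof (rule rotate_word)
        show "x \<notin> X" "weyl a ws (sroot x) = sroot x"
          using letters[OF less.prems, of x] us by auto
        show "l \<in> half_root_lattice"
          using l by simp
        show "in_BAB (Fw ?W * FKb e l)"
          using less.hyps[OF _ R[of 0]] len by simp
        show "in_BAB (Fw ?W * FKb e (l - mu a \<tau> ws x))"
          using less.hyps[OF _ R[of "- 1"]] len by simp
        fix ws1 ws2 :: "'i list" and n :: real
        assume W: "?W = ws1 @ \<tau> x # ws2" and n: "n \<in> {- 1, 1}"
        have "R (add_mset (\<tau> x) (mset (ws1 @ ws2))) (l - mu a \<tau> ws x)"
          using R[of "- 1"] unfolding W by simp
        then have "R (mset (ws1 @ ws2)) (l - mu a \<tau> ws x + n *\<^sub>R mu a \<tau> ws (\<tau> x))"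
          by (rule hereditary) (use n in auto)
        then show "in_BAB (Fw (ws1 @ ws2) * FKb e (l - mu a \<tau> ws x + n *\<^sub>R mu a \<tau> ws (\<tau> x)))"
          by (rule less.hyps[rotated]) (use len W in simp)
      qed
      have "(\<Sum>u\<leftarrow>?W. form a e (sroot x) (sroot u)) = (\<Sum>u\<in>#mset ?W. form a e (sroot x) (sroot u))"
        by (simp only: mset_map[symmetric] sum_mset_sum_list)
      then have "(\<Sum>u\<leftarrow>?W. form a e (sroot x) (sroot u)) - form a e l (sroot x + sroot (\<tau> x)) = \<rho> x"
        by (simp add: \<rho>_def us)
      then have "in_BAB (Fw ((x # xs) @ ys) * FKb e l - scal (c x / d x * qpow (\<rho> x)) * (Fw (xs @ (ys @ [x])) * FKb e l))"
        using step by (simp only: append_Cons append_assoc)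
      moreover have "in_BAB (Fw (xs @ (ys @ [x])) * FKb e l - scal (\<kappa> xs) * (Fw ((ys @ [x]) @ xs) * FKb e l))"
        using Cons.prems by (intro Cons.IH) simp
      ultimately have "in_BAB ((Fw ((x # xs) @ ys) * FKb e l - scal (c x / d x * qpow (\<rho> x)) * (Fw (xs @ (ys @ [x])) * FKb e l))
        + scal (c x / d x * qpow (\<rho> x)) * (Fw (xs @ (ys @ [x])) * FKb e l - scal (\<kappa> xs) * (Fw ((ys @ [x]) @ xs) * FKb e l)))"
        by (intro in_BAB_add in_BAB_scal)
      also have "(Fw ((x # xs) @ ys) * FKb e l - scal (c x / d x * qpow (\<rho> x)) * (Fw (xs @ (ys @ [x])) * FKb e l))
        + scal (c x / d x * qpow (\<rho> x)) * (Fw (xs @ (ys @ [x])) * FKb e l - scal (\<kappa> xs) * (Fw ((ys @ [x]) @ xs) * FKb e l))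
        = Fw ((x # xs) @ ys) * FKb e l - scal (c x / d x * qpow (\<rho> x) * \<kappa> xs) * (Fw (ys @ x # xs) * FKb e l)"
        by (simp only: right_diff_distrib mult.assoc[symmetric] scal_mult[symmetric] append_assoc append_Cons append_Nil)
          simp
      finally show ?case
        by (simp only: \<kappa>_def list.map prod_list.Cons)
    qed
    have "in_BAB (scal (1 - \<kappa> us) * (Fw us * FKb e l))"
      using rotate[of us "[]"] by (simp add: scal_diff left_diff_distrib)
    moreover have "1 - \<kappa> us \<noteq> 0"
    proof
      assume "1 - \<kappa> us = 0"
      have \<rho>_int: "2 * \<rho> x \<in> \<int>" for x
      proof -
        have "2 * form a e l (sroot x) \<in> \<int>" "2 * form a e l (sroot (\<tau> x)) \<in> \<int>"
          using form_half_integral l by blast+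
        moreover have "2 * (\<Sum>u\<leftarrow>us. form a e (sroot x) (sroot u)) \<in> \<int>" for us
          by (induction us) (auto simp: distrib_left form_sroot_sroot)
        then have "2 * (\<Sum>u\<in>#mset us. form a e (sroot x) (sroot u)) \<in> \<int>"
          by (simp only: mset_map[symmetric] sum_mset_sum_list)
        ultimately show ?thesis
          by (simp add: \<rho>_def form_add_right form_sroot_sroot right_diff_distrib distrib_left)
      qed
      have int: "2 * (\<Sum>x\<leftarrow>vs. \<rho> x) \<in> \<int>" for vs
        using \<rho>_int by (induction vs) (auto simp: distrib_left)
      have "qpow (\<Sum>x\<leftarrow>us. \<rho> x) = prod_list (map (\<lambda>x. qpow (\<rho> x)) us)"
        by (rule qpow_sum_list) (rule \<rho>_int)
      moreover have "\<kappa> us = prod_list (map (\<lambda>x. c x / d x) us) * prod_list (map (\<lambda>x. qpow (\<rho> x)) us)"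
        unfolding \<kappa>_def by (induction us) (simp_all add: mult_ac)
      moreover have "(\<Sum>x\<leftarrow>us. \<rho> x) = - resonance_exponent (mset us) l"
        unfolding resonance_exponent_def mset_map[symmetric] sum_mset_sum_list
        by (subst uminus_sum_list_map)
          (simp add: \<rho>_def[abs_def] o_def mset_map[symmetric] sum_mset_sum_list del: mset_map)
      ultimately have "prod_list (map (\<lambda>x. qpow (\<rho> x)) us) * prod_list (map (\<lambda>x. c x / d x) us) = 1"
        "qpow (resonance_exponent (mset us) l) = inverse (prod_list (map (\<lambda>x. qpow (\<rho> x)) us))"
        using \<open>1 - \<kappa> us = 0\<close> qpow_minus[OF int, of us] by (simp_all add: mult.commute)
      then have "prod_list (map (\<lambda>x. c x / d x) us) = qpow (resonance_exponent (mset us) l)"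
        by (simp only: inverse_unique)
      then show False
        using nonresonant[OF less.prems] False by (simp add: prod_mset_prod_list flip: mset_map)
    qed
    ultimately show ?thesis
      by (rule in_BAB_scal_cancel)
  qed
qed

end

lemma Theta_anti_invariant_sum:
  assumes "finite J" "\<And>j. j \<in> J \<Longrightarrow> f j \<in> half_root_lattice \<and> Theta a \<tau> ws (f j) = - f j"
  shows "sum f J \<in> half_root_lattice \<and> Theta a \<tau> ws (sum f J) = - sum f J"
  using assms
proof (induction J)
  case empty
  show ?case
    using Theta_scale[of a \<tau> ws 0 0] by simp
next
  case (insert j J)
  then show ?case
    by (simp add: half_root_lattice_add Theta_add)
qed

theorem theorem4p6:
  fixes a :: "'i::{finite, linorder} \<Rightarrow> 'i \<Rightarrow> int" and e :: "'i \<Rightarrow> int"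
    and X :: "'i set" and \<tau> :: "'i \<Rightarrow> 'i" and ws us :: "'i list"
    and c d s t :: "'i \<Rightarrow> qfield" and K :: "'i qfree set"
  assumes "symmetrizable_gcm a e"
    and "admissible_pair a e X \<tau> ws"
    and "qsp_parameters X c s"
    and "qsp_parameters X d t"
    and "simple_generators a e X \<tau> ws"
    and "set us \<subseteq> - X"
    and "K \<in> Areg a e \<tau> ws c d us"
  shows "K \<otimes>\<^bsub>Uq a e\<^esub> Fword a e us \<in> BAB a e X \<tau> ws c s d t"
proof -
  interpret admissible a e X \<tau> ws
    using assms(1,2) by unfold_locales
  let ?n = "length us"
  obtain l where K: "K = Kb a e l" and l: "l \<in> half_root_lattice" "Theta a \<tau> ws l = - l"
    and regular: "\<And>k vs N. k < ?n \<Longrightarrow> subseq vs us \<Longrightarrow> length vs = ?n - k \<Longrightarrow>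
      (\<And>j. j < ?n \<Longrightarrow> N j \<in> {- 1, 0, 1}) \<Longrightarrow>
      prod_list (map c vs) / prod_list (map d vs) \<noteq>
        qpow (regular_exponent a e \<tau> (l + (\<Sum>j<?n. N j *\<^sub>R mu a \<tau> ws (us ! j))) vs)"
    using assms(7) unfolding Areg_def by blast
  show ?thesis
  proof (cases "\<exists>u\<in>set us. cls a e (FF u) = cls a e 0")
    case True
    \<comment> \<open>Then the whole product vanishes. It is only for a nonzero \<open>F\<^sub>u\<close> that weights can tell how
      \<open>\<Theta>\<close> acts on \<open>\<alpha>\<^sub>u\<close>.\<close>
    then obtain u ys zs where u: "cls a e (FF u) = cls a e 0" "us = ys @ u # zs"
      by (meson split_list)
    have "cls a e (FKb e l * prod_list (map FF us))
        = cls a e (FKb e l * (prod_list (map FF ys) * (FF u * prod_list (map FF zs))))"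
      by (simp add: u)
    also have "\<dots> = cls a e (FKb e l * (prod_list (map FF ys) * (0 * prod_list (map FF zs))))"
      by (rule cls_cong_mult[OF refl cls_cong_mult[OF refl cls_cong_mult[OF u(1) refl]]])
    finally have "K \<otimes>\<^bsub>Uq a e\<^esub> Fword a e us = \<zero>\<^bsub>Uq a e\<^esub>"
      by (simp add: K Kb_def Fword_def cls_mult cls_zero)
    then show ?thesis
      by (simp add: BAB_def lin_span.zero)
  next
    case False
    have fixed: "u \<notin> X \<and> weyl a ws (sroot u) = sroot u" if "u \<in> set us" for u
      using that assms(6) simple_root_fixed[OF assms(5), of u] False by auto
    obtain v where v: "i \<notin> X \<Longrightarrow> v i \<noteq> 0 \<and>
        cls a e (theta_free a e X \<tau> ws (FF i * FKb e (sroot i))) = cls a e (- (scal (v i) * FE (\<tau> i)))" for i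
      using assms(5) unfolding simple_generators_def by metis
    interpret coideal_pair a e X \<tau> ws c d s t v
      using v assms(4) by unfold_locales (auto simp: qsp_parameters_def)
    \<comment> \<open>The set \<open>S\<close> collects the positions whose letters are still present; the shift \<open>N\<close> involves
      only letters that have been removed, each at most once.\<close>
    define R where "R A m \<longleftrightarrow> (\<exists>S N. S \<subseteq> {..<?n} \<and> (\<forall>j<?n. N j \<in> {- 1, 0, 1}) \<and> (\<forall>j\<in>S. N j = 0) \<and>
      A = image_mset ((!) us) (mset_set S) \<and> m = l + (\<Sum>j<?n. N j *\<^sub>R mu a \<tau> ws (us ! j)))"
      for A :: "'i multiset" and m :: "(real, 'i) vec"
    have mu: "N *\<^sub>R mu a \<tau> ws u \<in> half_root_lattice \<and> Theta a \<tau> ws (N *\<^sub>R mu a \<tau> ws u) = - (N *\<^sub>R mu a \<tau> ws u)"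
      if "u \<in> set us" "N \<in> {- 1, 0, 1}" for u and N :: real
    proof -
      have u: "u \<notin> X" "weyl a ws (sroot u) = sroot u"
        using fixed[OF that(1)] by auto
      have "mu a \<tau> ws u \<in> half_root_lattice"
        unfolding mu_eq[OF u] scaleR_right_distrib by (intro half_root_lattice_add half_root_lattice_half_sroot)
      moreover have "Theta a \<tau> ws (mu a \<tau> ws u) = - mu a \<tau> ws u"
        unfolding mu_eq[OF u] by (simp add: Theta_scale Theta_add Theta_of_fixed[OF u] algebra_simps)
      ultimately show ?thesis
        using that(2) half_root_lattice_uminus by (auto simp: Theta_scale)
    qed
    have "in_BAB (Fw us * FKb e l)"
    proof (rule word_in_span[of R])
      fix A m
      assume "R A m"
      then obtain S N where S: "S \<subseteq> {..<?n}" and N: "\<forall>j<?n. N j \<in> {- 1, 0, 1}" "\<forall>j\<in>S. N j = 0"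
        and A: "A = image_mset ((!) us) (mset_set S)"
        and m: "m = l + (\<Sum>j<?n. N j *\<^sub>R mu a \<tau> ws (us ! j))"
        unfolding R_def by blast
      have fin: "finite S"
        using S finite_subset by blast
      show "m \<in> half_root_lattice \<and> Theta a \<tau> ws m = - m"
        using Theta_anti_invariant_sum[of "{..<?n}" "\<lambda>j. N j *\<^sub>R mu a \<tau> ws (us ! j)" a \<tau> ws] mu N(1) l
        by (simp add: m half_root_lattice_add Theta_add)
      show "x \<notin> X \<and> weyl a ws (sroot x) = sroot x" if "x \<in># A" for x
        using that S fin by (intro fixed) (auto simp: A)
      show "(\<Prod>x\<in>#A. c x / d x) \<noteq> qpow (resonance_exponent A m)" if "A \<noteq> {#}"
      proof -
        define vs where "vs = map ((!) us) (filter (\<lambda>i. i \<in> S) [0..<?n])"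
        have "subseq vs (map ((!) us) [0..<?n])"
          unfolding vs_def by (intro subseq_map subseq_filter_left)
        then have sub: "subseq vs us"
          by (simp add: map_nth)
        have "{i \<in> {0..<?n}. i \<in> S} = S"
          using S by auto
        then have vs: "mset vs = A"
          by (simp add: vs_def A)
        then have "length vs = card S" "length vs \<noteq> 0"
          using that fin by (auto simp: A mset_set_empty_iff simp flip: size_mset)
        moreover have "card S \<le> ?n"
          using card_mono[OF _ S] by simp
        ultimately have "prod_list (map c vs) / prod_list (map d vs) \<noteq> qpow (regular_exponent a e \<tau> m vs)"
          using regular[of "?n - card S" vs N] sub N(1) by (simp add: m)
        moreover have "(\<Prod>x\<in>#A. c x / d x) = prod_list (map c vs) / prod_list (map d vs)"
          unfolding vs[symmetric] mset_map[symmetric] prod_mset_prod_list by (induction vs) simp_all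
        ultimately show ?thesis
          by (simp add: regular_exponent_eq vs)
      qed
    next
      fix A x m and n :: real
      assume "R (add_mset x A) m" and n: "n \<in> {- 1, 0, 1}"
      then obtain S N where S: "S \<subseteq> {..<?n}" and N: "\<forall>j<?n. N j \<in> {- 1, 0, 1}" "\<forall>j\<in>S. N j = 0"
        and A: "add_mset x A = image_mset ((!) us) (mset_set S)"
        and m: "m = l + (\<Sum>j<?n. N j *\<^sub>R mu a \<tau> ws (us ! j))"
        unfolding R_def by blast
      have fin: "finite S"
        using S finite_subset by blast
      have "x \<in># image_mset ((!) us) (mset_set S)"
        by (simp flip: A)
      then obtain p where p: "p \<in> S" "x = us ! p"
        using fin by auto
      then have p': "p \<in> {..<?n}"
        using S by blast
      have "A = image_mset ((!) us) (mset_set (S - {p}))"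
        using A p mset_set.remove[OF fin p(1)] by simp
      moreover have "(\<Sum>j<?n. (N(p := n)) j *\<^sub>R mu a \<tau> ws (us ! j))
          = (\<Sum>j<?n. N j *\<^sub>R mu a \<tau> ws (us ! j)) + n *\<^sub>R mu a \<tau> ws x"
        using N(2) p by (simp add: sum.remove[OF _ p'])
      ultimately show "R A (m + n *\<^sub>R mu a \<tau> ws x)"
        unfolding R_def using S N n by (intro exI[of _ "S - {p}"] exI[of _ "N(p := n)"]) (auto simp: m)
    next
      have "image_mset ((!) us) (mset_set {..<?n}) = mset (map ((!) us) [0..<?n])"
        by (simp add: atLeast0LessThan)
      then show "R (mset us) l"
        unfolding R_def by (intro exI[of _ "{..<?n}"] exI[of _ "\<lambda>_. 0"]) (simp add: map_nth)
    qed
    then have "in_BAB (FKb e l * Fw us)"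
      using in_BAB_cong[OF Kb_Fw[OF l(1), of us]] in_BAB_scal by blast
    then show ?thesis
      by (simp add: in_BAB_def K Kb_def Fword_def cls_mult)
  qed
qed

end
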